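(* Let $X\sim p_0=\mathcal N(\mu_0,\sigma_0^2)$ with $\sigma_0^2>0$, let $\pi(x,y,z)=\frac{1}{\sigma_0^2}[(z-x)^2-(y-x)^2]$, and let $R,R_s\ge 0$. Let $\mathcal P$ be the set of conditional distributions $p(y,u|x)$ satisfying $R_s\ge I(X;Y|U)$ and $R\ge I(X;U,Y)$. Then, when $(X,Y,U)$ is constrained to be jointly Gaussian, $$\max_{\substack{p(y,u|x)\in\mathcal P\\ (X,Y,U)\text{ jointly Gaussian}}}\ \min_{z(\cdot)}\ \mathbb E\,\pi(X,Y,z(U)) \;=\; 1-\exp(-2\min(R_s,R)).$$
   Context: $Y$ and $U$ are real-valued random variables generated from $X$ by the conditional distribution $p(y,u|x)$; the inner minimum is over functions $z$ of $u$. Mutual informations, and hence the rates $R,R_s$, are measured in nats (natural logarithm), and $\exp$ is the natural exponential. *)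

theory Defs
  imports "HOL-Probability.Probability"
begin

(* sigma is a standard deviation; sigma = 0 gives the point mass at mu. *)
definition gaussian_measure :: "real \<Rightarrow> real \<Rightarrow> real measure" where
  "gaussian_measure \<mu> \<sigma> =
     (if \<sigma> = 0 then return borel \<mu> else density lborel (\<lambda>x. ennreal (normal_density \<mu> \<sigma> x)))"

(* Joint Gaussianity in the usual sense that every linear combination is Gaussian; singular
   covariance matrices, hence also constant components, are allowed. *)
definition jointly_gaussian :: "(real \<times> real \<times> real) measure \<Rightarrow> bool" where
  "jointly_gaussian J \<longleftrightarrow>
     (\<forall>a b c. \<exists>m s. distr J borel (\<lambda>(x, y, u). a * x + b * y + c * u) = gaussian_measure m s)"

(* A conditional distribution p(y,u|x) is a probability kernel from x to pairs (y,u). *)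
definition kernels :: "(real \<Rightarrow> (real \<times> real) measure) set" where
  "kernels = measurable borel (prob_algebra (borel \<Otimes>\<^sub>M borel))"

(* The law of (X, Y, U) when X is normal and (Y, U) is drawn from K X. *)
definition joint_law ::
    "real \<Rightarrow> real \<Rightarrow> (real \<Rightarrow> (real \<times> real) measure) \<Rightarrow> (real \<times> real \<times> real) measure" where
  "joint_law \<mu> \<sigma> K =
     gaussian_measure \<mu> \<sigma> \<bind> (\<lambda>x. distr (K x) (borel \<Otimes>\<^sub>M borel \<Otimes>\<^sub>M borel) (Pair x))"

abbreviation X_of :: "real \<times> real \<times> real \<Rightarrow> real" where "X_of \<equiv> \<lambda>(x, y, u). x"
abbreviation Y_of :: "real \<times> real \<times> real \<Rightarrow> real" where "Y_of \<equiv> \<lambda>(x, y, u). y"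
abbreviation U_of :: "real \<times> real \<times> real \<Rightarrow> real" where "U_of \<equiv> \<lambda>(x, y, u). u"

(* prob_space.mutual_information is a Bochner integral of the log of a Radon-Nikodym derivative,
   so it is a meaningless real number when the mutual information is infinite. This extended
   version in nats is infinite when the joint law is not absolutely continuous with respect to
   the product of the marginals, or when the log density is not integrable under the joint law
   (its negative part always is). *)
definition mutual_information_nats ::
    "'a measure \<Rightarrow> 'b measure \<Rightarrow> 'c measure \<Rightarrow> ('a \<Rightarrow> 'b) \<Rightarrow> ('a \<Rightarrow> 'c) \<Rightarrow> ereal" where
  "mutual_information_nats M S T A B =
     (let P = distr M S A \<Otimes>\<^sub>M distr M T B;
          Q = distr M (S \<Otimes>\<^sub>M T) (\<lambda>\<omega>. (A \<omega>, B \<omega>))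
      in if absolutely_continuous P Q \<and> integrable Q (entropy_density (exp 1) P Q)
         then ereal (prob_space.mutual_information M (exp 1) S T A B)
         else \<infinity>)"

(* The constraints R >= I(X;U,Y) and Rs >= I(X;Y|U). The library's conditional mutual information
   is I(X;Y,U) - I(X;U) in terms of the real-valued mutual_information. The first constraint makes
   I(X;Y,U), and therefore also I(X;U), finite, so the difference is the true value of I(X;Y|U). *)
definition rate_constraints :: "real \<Rightarrow> real \<Rightarrow> (real \<times> real \<times> real) measure \<Rightarrow> bool" where
  "rate_constraints R Rs J \<longleftrightarrow>
     mutual_information_nats J borel (borel \<Otimes>\<^sub>M borel) X_of (\<lambda>\<omega>. (Y_of \<omega>, U_of \<omega>)) \<le> ereal R \<and>
     prob_space.conditional_mutual_information J (exp 1) borel borel borel X_of Y_of U_of \<le> Rs"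

definition payoff :: "real \<Rightarrow> real \<Rightarrow> real \<Rightarrow> real \<Rightarrow> real" where
  "payoff \<sigma> x y z = 1 / \<sigma>\<^sup>2 * ((z - x)\<^sup>2 - (y - x)\<^sup>2)"

(* Positive part minus negative part, so that infinite expectations keep their value (a Bochner
   integral would be 0). *)
definition ext_expectation :: "'a measure \<Rightarrow> ('a \<Rightarrow> real) \<Rightarrow> ereal" where
  "ext_expectation M f =
     enn2ereal (\<integral>\<^sup>+ \<omega>. ennreal (f \<omega>) \<partial>M) - enn2ereal (\<integral>\<^sup>+ \<omega>. ennreal (- f \<omega>) \<partial>M)"

definition expected_payoff ::
    "real \<Rightarrow> (real \<times> real \<times> real) measure \<Rightarrow> (real \<Rightarrow> real) \<Rightarrow> ereal" where
  "expected_payoff \<sigma> J z = ext_expectation J (\<lambda>(x, y, u). payoff \<sigma> x y (z u))"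

definition policies :: "real \<Rightarrow> real \<Rightarrow> real \<Rightarrow> real \<Rightarrow> (real \<Rightarrow> (real \<times> real) measure) set" where
  "policies \<mu> \<sigma> R Rs = {K \<in> kernels. rate_constraints R Rs (joint_law \<mu> \<sigma> K)}"

definition gaussian_policies ::
    "real \<Rightarrow> real \<Rightarrow> real \<Rightarrow> real \<Rightarrow> (real \<Rightarrow> (real \<times> real) measure) set" where
  "gaussian_policies \<mu> \<sigma> R Rs = {K \<in> policies \<mu> \<sigma> R Rs. jointly_gaussian (joint_law \<mu> \<sigma> K)}"

definition is_minimum :: "'a::order set \<Rightarrow> 'a \<Rightarrow> bool" where
  "is_minimum A m \<longleftrightarrow> m \<in> A \<and> (\<forall>a\<in>A. m \<le> a)"

definition is_maximum :: "'a::order set \<Rightarrow> 'a \<Rightarrow> bool" where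
  "is_maximum A m \<longleftrightarrow> m \<in> A \<and> (\<forall>a\<in>A. a \<le> m)"

end

theory Submission
  imports Defs
begin

text \<open>Against a given policy the best response is the linear regression of \<open>X\<close> on \<open>U\<close>, whose
  residual is independent of \<open>U\<close>. With \<open>s\<^sup>2 = Var(X|U)\<close> and \<open>D = E (Y - X)\<^sup>2\<close> the value of the
  policy is therefore \<open>(s\<^sup>2 - D) / \<sigma>\<^sup>2\<close>, and \<open>I(X;U) = ln (\<sigma>\<^sup>2 / s\<^sup>2) / 2\<close>
  if \<open>s \<noteq> 0\<close>. Gibbs' inequality
  with the trial density of \<open>N(y, d)\<close> relative to \<open>N(\<mu>, \<sigma>\<^sup>2)\<close> gives the rate-distortion bound
  \<open>I(X;Y,U) \<ge> ln (\<sigma>\<^sup>2 / d) / 2 + 1 / 2 - D / (2 d)\<close> for every \<open>d > 0\<close>. The two rate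
  constraints then yield \<open>D \<ge> \<sigma>\<^sup>2 exp (-2 R)\<close> and \<open>D \<ge> s\<^sup>2 exp (-2 Rs)\<close>, which together with
  \<open>s\<^sup>2 \<le> \<sigma>\<^sup>2\<close> is the upper bound. It is attained by the backward Gaussian test channel with
  constant \<open>U\<close>.\<close>

section \<open>Gaussian laws: affine form, characteristic function, moments\<close>

lemma sets_gaussian_measure [simp, measurable_cong]: "sets (gaussian_measure m s) = sets borel"
  by (simp add: gaussian_measure_def)

lemma space_gaussian_measure [simp]: "space (gaussian_measure m s) = UNIV"
  by (simp add: gaussian_measure_def)

text \<open>One affine formula covers point masses and negative \<open>s\<close> alike, so moments
  and characteristic functions can be computed once from the standard normal law.\<close>

lemma gaussian_measure_eq_distr:
  "gaussian_measure m s = distr std_normal_distribution borel (\<lambda>x. m + s * x)"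
proof -
  interpret N: prob_space std_normal_distribution
    by (rule prob_space_normal_density) simp
  show ?thesis
  proof (cases "s = 0")
    case False
    have "distributed std_normal_distribution lborel (\<lambda>x. x) std_normal_density"
      by (auto simp: distributed_def intro!: distr_id2)
    from N.normal_density_affine[OF this _ False, of m]
    have "distr std_normal_distribution lborel (\<lambda>x. m + s * x)
        = density lborel (normal_density m \<bar>s\<bar>)"
      by (auto simp: distributed_def)
    \<comment> \<open>The density depends on \<open>s\<close> only through \<open>s^2\<close>, which
      removes the absolute value produced by affine scaling.\<close>
    moreover have "normal_density m \<bar>s\<bar> = normal_density m s"
      by (auto simp: normal_density_def)
    moreover have "distr std_normal_distribution lborel (\<lambda>x. m + s * x)
        = distr std_normal_distribution borel (\<lambda>x. m + s * x)"
      by (rule distr_cong) auto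
    ultimately show ?thesis
      using False by (simp add: gaussian_measure_def)
  qed (simp add: gaussian_measure_def)
qed

lemma prob_space_gaussian_measure: "prob_space (gaussian_measure m s)"
  unfolding gaussian_measure_eq_distr
  by (intro prob_space.prob_space_distr prob_space_normal_density) auto

lemma real_distribution_gaussian_measure: "real_distribution (gaussian_measure m s)"
  using prob_space_gaussian_measure
  by (simp add: real_distribution_def real_distribution_axioms_def)

lemma char_gaussian_measure:
  "char (gaussian_measure m s) t = iexp (t * m) * of_real (exp (- (s * t)\<^sup>2 / 2))"
proof -
  have "char (gaussian_measure m s) t
      = (CLINT x|std_normal_distribution. iexp (t * m) * iexp ((s * t) * x))"
    unfolding gaussian_measure_eq_distr char_def
    by (subst integral_distr) (auto simp: algebra_simps exp_add intro!: Bochner_Integration.integral_cong)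
  also have "\<dots> = iexp (t * m) * char std_normal_distribution (s * t)"
    by (simp add: char_def)
  finally show ?thesis
    by (simp add: char_std_normal_distribution)
qed

lemma gaussian_measure_moments:
  shows integrable_gaussian_measure: "integrable (gaussian_measure m s) (\<lambda>x. x)"
    and integrable_gaussian_measure_square: "integrable (gaussian_measure m s) (\<lambda>x. x\<^sup>2)"
    and integral_gaussian_measure: "(\<integral>x. x \<partial>gaussian_measure m s) = m"
    and integral_gaussian_measure_square: "(\<integral>x. x\<^sup>2 \<partial>gaussian_measure m s) = m\<^sup>2 + s\<^sup>2"
proof -
  interpret N: prob_space std_normal_distribution
    by (rule prob_space_normal_density) simp
  have total: "measure std_normal_distribution UNIV = 1"
    using N.prob_space by simp
  have int1: "integrable std_normal_distribution (\<lambda>x. x)"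
    using integrable_std_normal_distribution_moment[of 1] by simp
  have int2: "integrable std_normal_distribution (\<lambda>x. x\<^sup>2)"
    by (rule integrable_std_normal_distribution_moment)
  have mean: "(\<integral>x. x \<partial>std_normal_distribution) = 0"
    using integral_std_normal_distribution_moment_odd[of 1] by simp
  have var: "(\<integral>x. x\<^sup>2 \<partial>std_normal_distribution) = 1"
    using std_normal_distribution_even_moments(1)[of 1] by simp
  have sq: "(m + s * x)\<^sup>2 = m\<^sup>2 + (2 * m * s * x + s\<^sup>2 * x\<^sup>2)" for x
    by (simp add: power2_eq_square algebra_simps)
  show "integrable (gaussian_measure m s) (\<lambda>x. x)"
    unfolding gaussian_measure_eq_distr
    by (subst integrable_distr_eq)
      (auto intro!: Bochner_Integration.integrable_add integrable_mult_right int1)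
  show "integrable (gaussian_measure m s) (\<lambda>x. x\<^sup>2)"
    unfolding gaussian_measure_eq_distr
    by (subst integrable_distr_eq)
      (auto simp: sq intro!: Bochner_Integration.integrable_add integrable_mult_right int1 int2)
  show "(\<integral>x. x \<partial>gaussian_measure m s) = m"
    unfolding gaussian_measure_eq_distr
    by (subst integral_distr) (simp_all add: int1 mean total)
  show "(\<integral>x. x\<^sup>2 \<partial>gaussian_measure m s) = m\<^sup>2 + s\<^sup>2"
    unfolding gaussian_measure_eq_distr
    by (subst integral_distr) (simp_all add: sq int1 int2 mean var total)
qed

context prob_space
begin

lemma gaussian_rv_moments:
  assumes [measurable]: "Z \<in> borel_measurable M"
    and Z: "distr M borel Z = gaussian_measure m s"
  shows gaussian_rv_integrable: "integrable M Z"
    and gaussian_rv_integrable_square: "integrable M (\<lambda>x. (Z x)\<^sup>2)"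
    and gaussian_rv_expectation: "expectation Z = m"
    and gaussian_rv_expectation_square: "expectation (\<lambda>x. (Z x)\<^sup>2) = m\<^sup>2 + s\<^sup>2"
    and gaussian_rv_char: "(CLINT x|M. iexp (Z x)) = iexp m * of_real (exp (- s\<^sup>2 / 2))"
  using gaussian_measure_moments[of m s] char_gaussian_measure[of m s 1]
  unfolding Z[symmetric] char_def
  by (simp_all add: integrable_distr_eq integral_distr)

lemma gaussian_rv_centered:
  assumes "Z \<in> borel_measurable M" "distr M borel Z = gaussian_measure m s"
  shows "integrable M (\<lambda>x. (Z x - m)\<^sup>2)" and "expectation (\<lambda>x. (Z x - m)\<^sup>2) = s\<^sup>2"
proof -
  have sq: "(Z x - m)\<^sup>2 = (Z x)\<^sup>2 - 2 * m * Z x + m\<^sup>2" for x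
    by (simp add: power2_eq_square algebra_simps)
  show "integrable M (\<lambda>x. (Z x - m)\<^sup>2)" "expectation (\<lambda>x. (Z x - m)\<^sup>2) = s\<^sup>2"
    unfolding sq using gaussian_rv_moments[OF assms] by (simp_all add: prob_space power2_eq_square)
qed

section \<open>Independence from characteristic functions\<close>

text \<open>Dividing by \<open>expectation h\<close> makes \<open>h\<close> a probability density.
  The factorization hypothesis says that \<open>W\<close> has the same characteristic function under
  the reweighted measure \<open>N\<close> as under \<open>M\<close>, so it has the same law under
  both; evaluating on \<open>A\<close> gives the claim.\<close>

lemma char_factor_imp_expectation_factor:
  fixes W h :: "'a \<Rightarrow> real"
  assumes [measurable]: "W \<in> borel_measurable M" "h \<in> borel_measurable M"
    and h: "\<And>x. 0 \<le> h x" "\<And>x. h x \<le> B"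
    and factor: "\<And>p. (CLINT x|M. iexp (p * W x) * h x) = (CLINT x|M. iexp (p * W x)) * expectation h"
    and [measurable]: "A \<in> sets borel"
  shows "expectation (\<lambda>x. indicat_real A (W x) * h x) = expectation (\<lambda>x. indicat_real A (W x)) * expectation h"
proof (cases "expectation h = 0")
  \<comment> \<open>Normalization is impossible here, but a nonnegative \<open>h\<close> with mean 0
    vanishes almost everywhere and both sides are 0.\<close>
  case True
  have int: "integrable M h"
    using h by (intro integrable_const_bound[of _ B]) auto
  have "AE x in M. h x = 0"
    using True int h by (subst (asm) integral_nonneg_eq_0_iff_AE) auto
  then have "expectation (\<lambda>x. indicat_real A (W x) * h x) = expectation (\<lambda>x. 0)"
    by (intro integral_cong_AE) auto
  with True show ?thesis by simp
next
  case False
  define c where "c = expectation h"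
  have c: "0 < c"
    using False h by (simp add: c_def less_le)
  have int: "integrable M h"
    using h by (intro integrable_const_bound[of _ B]) auto
  define N where "N = density M (\<lambda>x. h x / c)"
  have [measurable_cong, simp]: "sets N = sets M"
    by (simp add: N_def)
  have "emeasure N (space N) = (\<integral>\<^sup>+x. ennreal (h x / c) \<partial>M)"
    by (simp add: N_def emeasure_density cong: nn_integral_cong)
  also have "\<dots> = ennreal (\<integral>x. h x / c \<partial>M)"
    using int c h by (intro nn_integral_eq_integral) auto
  also have "(\<integral>x. h x / c \<partial>M) = 1"
    using c by (simp add: c_def)
  finally interpret N: prob_space N
    by (intro prob_spaceI) simp
  have "distr N borel W = distr M borel W"
  proof (rule Levy_uniqueness)
    show "char (distr N borel W) = char (distr M borel W)"
    proof
      fix p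
      have "char (distr N borel W) p = (CLINT x|N. iexp (p * W x))"
        by (simp add: char_def integral_distr)
      also have "\<dots> = (CLINT x|M. (h x / c) *\<^sub>R iexp (p * W x))"
        unfolding N_def using c h by (subst integral_density) auto
      also have "\<dots> = (CLINT x|M. iexp (p * W x) * h x) / c"
        by (simp add: scaleR_conv_of_real mult.commute)
      also have "\<dots> = char (distr M borel W) p"
        unfolding factor using c by (simp add: char_def integral_distr c_def)
      finally show "char (distr N borel W) p = char (distr M borel W) p" .
    qed
  qed auto
  then have "(\<integral>x. indicat_real A x \<partial>distr N borel W) = (\<integral>x. indicat_real A x \<partial>distr M borel W)"
    by simp
  then have "(\<integral>x. indicat_real A (W x) \<partial>N) = expectation (\<lambda>x. indicator A (W x))"
    by (subst (asm) (1 2) integral_distr) auto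
  also have "(\<integral>x. indicat_real A (W x) \<partial>N) = (\<integral>x. (h x / c) *\<^sub>R indicator A (W x) \<partial>M)"
    unfolding N_def using c h by (subst integral_density) auto
  also have "\<dots> = expectation (\<lambda>x. indicator A (W x) * h x) / c"
    by (simp add: mult.commute)
  finally show ?thesis
    using c by (simp add: c_def field_simps)
qed

text \<open>Weights have to be nonnegative, so a character of \<open>U\<close> enters through
  \<open>1 + cos\<close>, expanded here by Euler's formula. The phase \<open>r\<close> lets one
  identity serve for cosine and sine.\<close>

lemma expectation_cos_eq:
  assumes [measurable]: "f \<in> borel_measurable M" "U \<in> borel_measurable M"
    and f: "\<And>x. norm (f x :: complex) \<le> B"
  shows "(CLINT x|M. f x * of_real (1 + cos (q * U x + r)))
    = (CLINT x|M. f x) + (iexp r * (CLINT x|M. f x * iexp (q * U x))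
      + iexp (- r) * (CLINT x|M. f x * iexp (- q * U x))) / 2"
proof -
  have e: "f x * of_real (1 + cos (q * U x + r))
      = f x + (iexp r * (f x * iexp (q * U x)) + iexp (- r) * (f x * iexp (- q * U x))) / 2" for x
    by (simp add: cos_exp_eq cos_of_real[symmetric] exp_add[symmetric] algebra_simps)
  have int: "integrable M f"
    using f by (intro integrable_const_bound[of _ B]) auto
  have int2: "integrable M (\<lambda>x. f x * iexp (t * U x))" for t
    using f by (intro integrable_const_bound[of _ B]) (auto simp: norm_mult)
  show ?thesis
    unfolding e using int int2[of q] int2[of "-q"] by simp
qed

lemma integrable_mult_if_integrable_square:
  fixes f g :: "'a \<Rightarrow> real"
  assumes [measurable]: "f \<in> borel_measurable M" "g \<in> borel_measurable M"
    and "integrable M (\<lambda>x. (f x)\<^sup>2)" "integrable M (\<lambda>x. (g x)\<^sup>2)"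
  shows "integrable M (\<lambda>x. f x * g x)"
proof (rule Bochner_Integration.integrable_bound)
  show "integrable M (\<lambda>x. (f x)\<^sup>2 + (g x)\<^sup>2)"
    using assms by simp
  have "\<bar>a * b\<bar> \<le> a\<^sup>2 + b\<^sup>2" for a b :: real
    using sum_squares_bound[of "\<bar>a\<bar>" "\<bar>b\<bar>"] mult_nonneg_nonneg[OF abs_ge_zero abs_ge_zero, of a b]
    unfolding abs_mult power2_abs by linarith
  then show "AE x in M. norm (f x * g x) \<le> norm ((f x)\<^sup>2 + (g x)\<^sup>2)"
    by simp
qed simp

text \<open>Weighting the measure by a nonnegative \<open>h\<close> turns the one-dimensional Levy uniqueness theorem
  into a factorization of \<open>E (1\<^sub>A(W) h)\<close>. It is used twice: with \<open>h = 1 + cos (q U + r)\<close>, which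
  recovers the characters of \<open>U\<close>, and then with \<open>U\<close> in place of \<open>W\<close> and \<open>h = 1\<^sub>A(W)\<close>.\<close>

lemma indep_var_if_char_factor:
  fixes W U :: "'a \<Rightarrow> real"
  assumes [measurable]: "W \<in> borel_measurable M" "U \<in> borel_measurable M"
    and factor: "\<And>p q. (CLINT x|M. iexp (p * W x) * iexp (q * U x))
      = (CLINT x|M. iexp (p * W x)) * (CLINT x|M. iexp (q * U x))"
  shows "indep_var borel W borel U"
proof -
  have cos_factor: "expectation (\<lambda>x. indicat_real A (W x) * cos (q * U x + r))
      = expectation (\<lambda>x. indicat_real A (W x)) * expectation (\<lambda>x. cos (q * U x + r))"
    if [measurable]: "A \<in> sets borel" for A q r
  proof -
    have int_cos: "integrable M (\<lambda>x. cos (q * U x + r))"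
      by (intro integrable_const_bound[of _ 1]) auto
    have int_ind: "integrable M (\<lambda>x. indicat_real A (W x))"
      by (intro integrable_const_bound[of _ 1]) (auto simp: indicator_def)
    have int_ind_cos: "integrable M (\<lambda>x. indicat_real A (W x) * cos (q * U x + r))"
      by (intro integrable_const_bound[of _ 1]) (auto simp: indicator_def)
    have one: "complex_of_real (expectation (\<lambda>x. 1 + cos (q * U x + r)))
        = 1 + (iexp r * (CLINT x|M. iexp (q * U x)) + iexp (- r) * (CLINT x|M. iexp (- q * U x))) / 2"
      using expectation_cos_eq[of "\<lambda>x. 1" U 1 q r] prob_space
      by (simp add: integral_complex_of_real[symmetric] del: of_real_add integral_complex_of_real)
    \<comment> \<open>The hypothesis \<open>factor\<close> applies to each exponential in the
      expansion of the weight; the contribution of the constant 1 is subtracted again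
      afterwards.\<close>
    have "expectation (\<lambda>x. indicat_real A (W x) * (1 + cos (q * U x + r)))
        = expectation (\<lambda>x. indicat_real A (W x)) * expectation (\<lambda>x. 1 + cos (q * U x + r))"
    proof (rule char_factor_imp_expectation_factor)
      show "0 \<le> 1 + cos (q * U x + r)" "1 + cos (q * U x + r) \<le> 2" for x
        using cos_ge_minus_one[of "q * U x + r"] cos_le_one[of "q * U x + r"] by linarith+
      show "(CLINT x|M. iexp (p * W x) * of_real (1 + cos (q * U x + r)))
          = (CLINT x|M. iexp (p * W x)) * of_real (expectation (\<lambda>x. 1 + cos (q * U x + r)))" for p
        by (subst expectation_cos_eq[where B = 1])
          (simp_all only: one factor, simp_all add: algebra_simps)
    qed measurable
    then show ?thesis
      using int_cos int_ind int_ind_cos prob_space by (simp add: distrib_left)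
  qed
  have ind_factor: "(CLINT x|M. iexp (q * U x) * of_real (indicat_real A (W x)))
      = (CLINT x|M. iexp (q * U x)) * of_real (expectation (\<lambda>x. indicat_real A (W x)))"
    if [measurable]: "A \<in> sets borel" for A q
  proof (rule complex_eqI)
    have int: "integrable M (\<lambda>x. iexp (q * U x) * of_real (indicat_real A (W x)))"
      by (intro integrable_const_bound[of _ 1]) (auto simp: indicator_def norm_mult)
    have int2: "integrable M (\<lambda>x. iexp (q * U x))"
      by (intro integrable_const_bound[of _ 1]) auto
    \<comment> \<open>Phase 0 yields the real part of the character and phase
      \<open>- pi / 2\<close> the imaginary part.\<close>
    have sin_eq: "cos (q * U x - pi / 2) = sin (q * U x)" for x
      by (simp add: cos_diff)
    show "Re (CLINT x|M. iexp (q * U x) * of_real (indicat_real A (W x)))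
      = Re ((CLINT x|M. iexp (q * U x)) * of_real (expectation (\<lambda>x. indicat_real A (W x))))"
      using cos_factor[OF that, of q 0] int int2
      by (simp add: integral_Re[symmetric] Re_exp mult.commute del: integral_Re)
    show "Im (CLINT x|M. iexp (q * U x) * of_real (indicat_real A (W x)))
      = Im ((CLINT x|M. iexp (q * U x)) * of_real (expectation (\<lambda>x. indicat_real A (W x))))"
      using cos_factor[OF that, of q "- pi / 2"] int int2
      by (simp add: integral_Im[symmetric] Im_exp sin_eq mult.commute del: integral_Im)
  qed
  have "distr M borel W \<Otimes>\<^sub>M distr M borel U = distr M (borel \<Otimes>\<^sub>M borel) (\<lambda>x. (W x, U x))"
  proof (rule pair_measure_eqI)
    show "sigma_finite_measure (distr M borel W)" "sigma_finite_measure (distr M borel U)"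
      by (auto intro!: prob_space_imp_sigma_finite prob_space_distr)
    fix A B assume "A \<in> sets (distr M borel W)" "B \<in> sets (distr M borel U)"
    then have [measurable]: "A \<in> sets borel" "B \<in> sets borel"
      by auto
    have "expectation (\<lambda>x. indicat_real B (U x) * indicat_real A (W x))
        = expectation (\<lambda>x. indicat_real B (U x)) * expectation (\<lambda>x. indicat_real A (W x))"
    proof (rule char_factor_imp_expectation_factor[where B = 1])
      show "(CLINT x|M. iexp (p * U x) * of_real (indicat_real A (W x)))
          = (CLINT x|M. iexp (p * U x)) * of_real (expectation (\<lambda>x. indicat_real A (W x)))" for p
        by (rule ind_factor) simp
    qed simp_all
    moreover have "indicat_real B (U x) * indicator A (W x)
        = indicat_real ((\<lambda>x. (W x, U x)) -` (A \<times> B) \<inter> space M) x" if "x \<in> space M" for x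
      using that by (auto simp: indicator_def)
    moreover have "indicat_real C (V x) = indicat_real (V -` C \<inter> space M) x" if "x \<in> space M"
      for V :: "'a \<Rightarrow> real" and C x
      using that by (auto simp: indicator_def)
    ultimately have "prob ((\<lambda>x. (W x, U x)) -` (A \<times> B) \<inter> space M)
        = prob (U -` B \<inter> space M) * prob (W -` A \<inter> space M)"
      by (simp cong: Bochner_Integration.integral_cong)
    then show "emeasure (distr M borel W) A * emeasure (distr M borel U) B
        = emeasure (distr M (borel \<Otimes>\<^sub>M borel) (\<lambda>x. (W x, U x))) (A \<times> B)"
      by (simp add: emeasure_distr emeasure_eq_measure ennreal_mult[symmetric] mult.commute)
  qed auto
  then show ?thesis
    by (simp add: indep_var_distribution_eq)
qed

text \<open>A Gaussian law is determined by its mean and variance, and zero covariance makes the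
  variance of \<open>p * W + q * U\<close> split into a \<open>W\<close> part and a \<open>U\<close>
  part. The characteristic function therefore factors. The argument involves no joint density, so
  degenerate \<open>W\<close> or \<open>U\<close> are covered.\<close>

lemma indep_var_if_uncorrelated_gaussian:
  fixes W U :: "'a \<Rightarrow> real"
  assumes [measurable]: "W \<in> borel_measurable M" "U \<in> borel_measurable M"
    and gaussian: "\<And>p q. \<exists>m s. distr M borel (\<lambda>x. p * W x + q * U x) = gaussian_measure m s"
    and uncorrelated: "expectation (\<lambda>x. W x * U x) = expectation W * expectation U"
  shows "indep_var borel W borel U"
proof (rule indep_var_if_char_factor)
  obtain m s where "distr M borel W = gaussian_measure m s"
    using gaussian[of 1 0] by auto
  then have W: "integrable M W" "integrable M (\<lambda>x. (W x)\<^sup>2)"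
    by (auto intro: gaussian_rv_integrable gaussian_rv_integrable_square)
  obtain m s where "distr M borel U = gaussian_measure m s"
    using gaussian[of 0 1] by auto
  then have U: "integrable M U" "integrable M (\<lambda>x. (U x)\<^sup>2)"
    by (auto intro: gaussian_rv_integrable gaussian_rv_integrable_square)
  have WU: "integrable M (\<lambda>x. W x * U x)"
    using W U by (intro integrable_mult_if_integrable_square) auto
  \<comment> \<open>This is the variance of \<open>p * W + q * U\<close> with the vanishing
    covariance term dropped; it satisfies \<open>v p q = v p 0 + v 0 q\<close>.\<close>
  define v where "v p q = p\<^sup>2 * variance W + q\<^sup>2 * variance U" for p q
  have char: "(CLINT x|M. iexp (p * W x + q * U x))
      = iexp (p * expectation W + q * expectation U) * of_real (exp (- v p q / 2))" for p q
  proof -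
    obtain m s where Z: "distr M borel (\<lambda>x. p * W x + q * U x) = gaussian_measure m s"
      using gaussian[of p q] by auto
    have mean: "m = p * expectation W + q * expectation U"
      using gaussian_rv_expectation[OF _ Z] W U by simp
    have "(p * W x + q * U x)\<^sup>2 = p\<^sup>2 * (W x)\<^sup>2 + (2 * p * q * (W x * U x) + q\<^sup>2 * (U x)\<^sup>2)" for x
      by (simp add: power2_eq_square algebra_simps)
    then have "m\<^sup>2 + s\<^sup>2 = p\<^sup>2 * expectation (\<lambda>x. (W x)\<^sup>2)
        + (2 * p * q * (expectation W * expectation U) + q\<^sup>2 * expectation (\<lambda>x. (U x)\<^sup>2))"
      using gaussian_rv_expectation_square[OF _ Z] W U WU uncorrelated by simp
    then have "s\<^sup>2 = v p q"
      using W U by (simp add: mean v_def variance_eq prob_space power2_eq_square algebra_simps)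
    with gaussian_rv_char[OF _ Z] show ?thesis
      by (simp add: mean)
  qed
  fix p q
  have "(CLINT x|M. iexp (p * W x) * iexp (q * U x)) = (CLINT x|M. iexp (p * W x + q * U x))"
    by (simp add: distrib_left exp_add)
  also have "\<dots> = (iexp (p * expectation W) * of_real (exp (- v p 0 / 2)))
      * (iexp (q * expectation U) * of_real (exp (- v 0 q / 2)))"
    unfolding char
    by (simp add: v_def distrib_left exp_add[symmetric] add_divide_distrib diff_divide_distrib exp_of_real[symmetric] algebra_simps
        del: exp_of_real)
  also have "\<dots> = (CLINT x|M. iexp (p * W x)) * (CLINT x|M. iexp (q * U x))"
    using char[of p 0] char[of 0 q] by simp
  finally show "(CLINT x|M. iexp (p * W x) * iexp (q * U x))
      = (CLINT x|M. iexp (p * W x)) * (CLINT x|M. iexp (q * U x))" .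
qed simp_all

end

section \<open>Normal densities and relative entropy\<close>

lemma normal_density_pos': "\<sigma> \<noteq> 0 \<Longrightarrow> 0 < normal_density \<mu> \<sigma> x"
  by (simp add: normal_density_def)

lemma nn_integral_gaussian_measure:
  fixes f :: "real \<Rightarrow> ennreal"
  assumes "s \<noteq> 0" and [measurable]: "f \<in> borel_measurable borel"
  shows "(\<integral>\<^sup>+x. f x \<partial>gaussian_measure m s) = (\<integral>\<^sup>+x. ennreal (normal_density m s x) * f x \<partial>lborel)"
  using assms by (simp add: gaussian_measure_def nn_integral_density)

lemma nn_integral_normal_density:
  assumes "s \<noteq> 0"
  shows "(\<integral>\<^sup>+x. normal_density m s x \<partial>lborel) = 1"
  using nn_integral_gaussian_measure[OF assms, of "\<lambda>_. 1" m]
    prob_space.emeasure_space_1[OF prob_space_gaussian_measure[of m s]] by simp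

lemma ln_normal_density_ratio:
  assumes "s \<noteq> 0" "\<sigma> \<noteq> 0"
  shows "ln (normal_density a s x / normal_density \<mu> \<sigma> x)
    = ln (\<sigma>\<^sup>2 / s\<^sup>2) / 2 - (x - a)\<^sup>2 / (2 * s\<^sup>2) + (x - \<mu>)\<^sup>2 / (2 * \<sigma>\<^sup>2)"
proof -
  have ln_density: "ln (normal_density a s x) = - (ln (2 * pi) + ln (s\<^sup>2)) / 2 - (x - a)\<^sup>2 / (2 * s\<^sup>2)"
    if "s \<noteq> 0" for a s
    using that by (simp add: normal_density_def ln_mult ln_div ln_sqrt) (simp add: field_simps)
  show ?thesis
    using assms by (simp add: ln_div ln_density normal_density_pos' less_imp_neq[symmetric])
      (simp add: field_simps)
qed

text \<open>The divergence is defined through \<open>RN_deriv\<close>, which is determined only up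
  to null sets. Uniqueness identifies it with the explicit density \<open>g\<close> almost
  everywhere in \<open>P\<close>, and absolute continuity carries this over to
  \<open>Q\<close>.\<close>

lemma KL_divergence_density:
  fixes g :: "'a \<Rightarrow> real"
  assumes P: "prob_space P" and [measurable]: "g \<in> borel_measurable P"
    and g: "\<And>x. x \<in> space P \<Longrightarrow> 0 < g x"
    and Q: "Q = density P g" and int: "integrable Q (\<lambda>x. ln (g x))"
  shows "absolutely_continuous P Q"
    and "integrable Q (entropy_density (exp 1) P Q)"
    and "KL_divergence (exp 1) P Q = (\<integral>x. ln (g x) \<partial>Q)"
proof -
  interpret P: prob_space P by fact
  have [measurable_cong, simp]: "sets Q = sets P"
    by (simp add: Q)
  show ac: "absolutely_continuous P Q"
    unfolding Q by (rule absolutely_continuousI_density) simp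
  have "AE x in P. RN_deriv P Q x = g x"
  proof -
    have "AE x in P. ennreal (g x) = RN_deriv P Q x"
      by (rule P.RN_deriv_unique) (simp_all add: Q)
    then show ?thesis
      by eventually_elim simp
  qed
  then have "AE x in Q. RN_deriv P Q x = g x"
    by (rule absolutely_continuous_AE[OF _ ac, rotated]) simp
  with AE_space have *: "AE x in Q. entropy_density (exp 1) P Q x = ln (g x)"
  proof eventually_elim
    case (elim x)
    then have "0 < g x"
      using g sets_eq_imp_space_eq[of Q P] by simp
    with elim show ?case
      by (simp add: entropy_density_def log_def)
  qed
  show "integrable Q (entropy_density (exp 1) P Q)"
    using int by (subst integrable_cong_AE[OF _ _ *]) auto
  show "KL_divergence (exp 1) P Q = (\<integral>x. ln (g x) \<partial>Q)"
    unfolding KL_divergence_def by (rule integral_cong_AE[OF _ _ *]) auto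
qed

text \<open>Gibbs' inequality in variational form. With \<open>D\<close> the true density of
  \<open>Q\<close>, integrate \<open>ln (g / D) \<le> g / D - 1\<close> against \<open>Q\<close> and
  use that \<open>g / D\<close> has \<open>Q\<close>-mean at most the \<open>P\<close>-mass of
  \<open>g\<close>.\<close>

lemma integral_ln_le_KL_divergence:
  fixes g :: "'a \<Rightarrow> real"
  assumes P: "prob_space P" and Q: "prob_space Q" and [measurable_cong, simp]: "sets Q = sets P"
    and ac: "absolutely_continuous P Q"
    and int: "integrable Q (entropy_density (exp 1) P Q)"
    and [measurable]: "g \<in> borel_measurable P" and g: "\<And>x. x \<in> space P \<Longrightarrow> 0 < g x"
    and le_1: "(\<integral>\<^sup>+x. g x \<partial>P) \<le> 1"
    and int_g: "integrable Q (\<lambda>x. ln (g x))"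
  shows "(\<integral>x. ln (g x) \<partial>Q) \<le> KL_divergence (exp 1) P Q"
proof -
  interpret P: prob_space P by fact
  interpret Q: prob_space Q by fact
  have "finite_measure Q" by unfold_locales
  from P.real_RN_deriv[OF this ac] obtain D where [measurable]: "D \<in> borel_measurable P"
    and D: "AE x in P. RN_deriv P Q x = ennreal (D x)" "AE x in Q. 0 < D x" "\<And>x. 0 \<le> D x"
    by auto
  have "Q = density P (RN_deriv P Q)"
    using ac by (simp add: P.density_RN_deriv)
  also have "\<dots> = density P D"
    using D by (auto intro!: density_cong)
  finally have Q_eq: "Q = density P D" .
  have "(\<integral>\<^sup>+x. ennreal (g x / D x) \<partial>Q) = (\<integral>\<^sup>+x. ennreal (D x) * ennreal (g x / D x) \<partial>P)"
    unfolding Q_eq by (subst nn_integral_density) auto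
  \<comment> \<open>Only an inequality: where \<open>D x = 0\<close> the quotient is 0 and the mass
    of \<open>g\<close> is lost.\<close>
  also have "\<dots> \<le> (\<integral>\<^sup>+x. ennreal (g x) \<partial>P)"
    using D(3) g
    by (intro nn_integral_mono) (auto simp: ennreal_mult'[symmetric] less_imp_le)
  finally have le_1': "(\<integral>\<^sup>+x. ennreal (g x / D x) \<partial>Q) \<le> 1"
    using le_1 by simp
  have pos: "AE x in Q. 0 \<le> g x / D x"
    using AE_space D(3) g sets_eq_imp_space_eq[of Q P] by (intro AE_I2) (auto simp: less_imp_le)
  have int_D: "integrable Q (\<lambda>x. g x / D x)"
    using le_1' pos by (intro integrableI_nonneg) (auto simp: top_unique less_top[symmetric])
  have le_1'': "(\<integral>x. g x / D x \<partial>Q) \<le> 1"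
    using le_1' nn_integral_eq_integral[OF int_D pos] by simp
  have "AE x in Q. RN_deriv P Q x = ennreal (D x)"
    using D(1) by (rule absolutely_continuous_AE[OF _ ac, rotated]) simp
  with AE_space D(2) have "AE x in Q. ln (g x) \<le> entropy_density (exp 1) P Q x + (g x / D x - 1)"
  proof eventually_elim
    case (elim x)
    then have "0 < g x"
      using g sets_eq_imp_space_eq[of Q P] by simp
    with elim have "ln (g x) - ln (D x) \<le> g x / D x - 1"
      using ln_le_minus_one[of "g x / D x"] by (simp add: ln_div)
    with elim show ?case
      by (simp add: entropy_density_def log_def)
  qed
  then have "(\<integral>x. ln (g x) \<partial>Q) \<le> (\<integral>x. entropy_density (exp 1) P Q x + (g x / D x - 1) \<partial>Q)"
    using int int_g int_D by (intro integral_mono_AE) auto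
  also have "\<dots> = KL_divergence (exp 1) P Q + ((\<integral>x. g x / D x \<partial>Q) - 1)"
    using int int_D by (simp add: KL_divergence_def Q.prob_space)
  finally show ?thesis
    using le_1'' by simp
qed

section \<open>Mutual information with a Gaussian residual; the rate-distortion bound\<close>

context prob_space
begin

text \<open>Given \<open>V = v\<close>, the variable \<open>X\<close> is \<open>\<alpha> v\<close>
  plus an independent centered Gaussian, so its conditional law is normal around
  \<open>\<alpha> v\<close>. Relative to the product of the marginals the joint law thus has the
  ratio of conditional to marginal density.\<close>

lemma distr_eq_density_if_gaussian_residual:
  fixes X :: "'a \<Rightarrow> real" and V :: "'a \<Rightarrow> 'b" and \<alpha> :: "'b \<Rightarrow> real"
  assumes [measurable]: "X \<in> borel_measurable M" "V \<in> measurable M T" "\<alpha> \<in> borel_measurable T"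
    and X: "distr M borel X = gaussian_measure \<mu> \<sigma>" and "\<sigma> \<noteq> 0"
    and W: "distr M borel (\<lambda>x. X x - \<alpha> (V x)) = gaussian_measure 0 s" and "s \<noteq> 0"
    and indep: "distr M (borel \<Otimes>\<^sub>M T) (\<lambda>x. (X x - \<alpha> (V x), V x))
      = distr M borel (\<lambda>x. X x - \<alpha> (V x)) \<Otimes>\<^sub>M distr M T V"
  shows "distr M (borel \<Otimes>\<^sub>M T) (\<lambda>x. (X x, V x))
    = density (distr M borel X \<Otimes>\<^sub>M distr M T V)
        (\<lambda>(x, v). ennreal (normal_density (\<alpha> v) s x / normal_density \<mu> \<sigma> x))"
    (is "?Q = density ?P ?g")
proof (rule measure_eqI)
  interpret T: prob_space "distr M T V"
    by (rule prob_space_distr) simp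
  interpret X: prob_space "distr M borel X"
    by (rule prob_space_distr) simp
  interpret W: prob_space "gaussian_measure 0 s"
    by (rule prob_space_gaussian_measure)
  interpret XT: pair_sigma_finite "distr M borel X" "distr M T V" ..
  interpret WT: pair_sigma_finite "gaussian_measure 0 s" "distr M T V" ..
  show "sets ?Q = sets (density ?P ?g)"
    by simp
  fix A assume "A \<in> sets ?Q"
  then have [measurable]: "A \<in> sets (borel \<Otimes>\<^sub>M T)"
    by simp
  have [measurable]: "?g \<in> borel_measurable (borel \<Otimes>\<^sub>M T)"
    by (auto simp: normal_density_def)
  have "emeasure ?Q A = (\<integral>\<^sup>+x. indicator A x \<partial>?Q)"
    by simp
  also have "\<dots> = (\<integral>\<^sup>+x. indicator A (X x, V x) \<partial>M)"
    by (subst nn_integral_distr) auto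
  \<comment> \<open>The shear \<open>(w, v) \<mapsto> (w + \<alpha> v, v)\<close> recovers
    \<open>(X, V)\<close> from the independent pair of residual and \<open>V\<close>.\<close>
  also have "\<dots> = (\<integral>\<^sup>+x. (\<lambda>(w, v). indicator A (w + \<alpha> v, v)) (X x - \<alpha> (V x), V x) \<partial>M)"
    by simp
  also have "\<dots> = (\<integral>\<^sup>+z. (\<lambda>(w, v). indicator A (w + \<alpha> v, v)) z
      \<partial>distr M (borel \<Otimes>\<^sub>M T) (\<lambda>x. (X x - \<alpha> (V x), V x)))"
    by (subst nn_integral_distr) auto
  also have "distr M (borel \<Otimes>\<^sub>M T) (\<lambda>x. (X x - \<alpha> (V x), V x)) = gaussian_measure 0 s \<Otimes>\<^sub>M distr M T V"
    using indep unfolding W .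
  also have "(\<integral>\<^sup>+z. (\<lambda>(w, v). indicator A (w + \<alpha> v, v)) z \<partial>(gaussian_measure 0 s \<Otimes>\<^sub>M distr M T V))
      = (\<integral>\<^sup>+v. \<integral>\<^sup>+w. indicator A (w + \<alpha> v, v) \<partial>gaussian_measure 0 s \<partial>distr M T V)"
    by (subst WT.nn_integral_snd[symmetric]) (auto simp: split_beta')
  also have "\<dots> = (\<integral>\<^sup>+v. \<integral>\<^sup>+x. ?g (x, v) * indicator A (x, v) \<partial>distr M borel X \<partial>distr M T V)"
  proof (rule nn_integral_cong)
    fix v assume "v \<in> space (distr M T V)"
    then have [measurable]: "v \<in> space T"
      by simp
    have "(\<integral>\<^sup>+w. indicator A (w + \<alpha> v, v) \<partial>gaussian_measure 0 s)
        = (\<integral>\<^sup>+w. ennreal (normal_density 0 s w) * indicator A (w + \<alpha> v, v) \<partial>lborel)"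
      using \<open>s \<noteq> 0\<close> by (intro nn_integral_gaussian_measure) auto
    \<comment> \<open>For fixed \<open>v\<close> the shear is a translation, which preserves
      Lebesgue measure and moves the center of the density from 0 to
      \<open>\<alpha> v\<close>.\<close>
    also have "\<dots> = (\<integral>\<^sup>+x. ennreal (normal_density (\<alpha> v) s x) * indicator A (x, v) \<partial>lborel)"
      by (subst nn_integral_real_affine[where c = 1 and t = "- \<alpha> v"]) (auto simp: normal_density_def)
    also have "\<dots> = (\<integral>\<^sup>+x. ennreal (normal_density \<mu> \<sigma> x) * (?g (x, v) * indicator A (x, v)) \<partial>lborel)"
      using \<open>\<sigma> \<noteq> 0\<close>
      by (intro nn_integral_cong)
        (simp add: mult.assoc[symmetric] ennreal_mult''[symmetric] normal_density_pos' less_imp_neq[symmetric])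
    also have "\<dots> = (\<integral>\<^sup>+x. ?g (x, v) * indicator A (x, v) \<partial>distr M borel X)"
      unfolding X using \<open>\<sigma> \<noteq> 0\<close> by (intro nn_integral_gaussian_measure[symmetric]) auto
    finally show "(\<integral>\<^sup>+w. indicator A (w + \<alpha> v, v) \<partial>gaussian_measure 0 s)
        = (\<integral>\<^sup>+x. ?g (x, v) * indicator A (x, v) \<partial>distr M borel X)" .
  qed
  also have "\<dots> = (\<integral>\<^sup>+z. ?g z * indicator A z \<partial>?P)"
    by (subst XT.nn_integral_snd) auto
  also have "\<dots> = emeasure (density ?P ?g) A"
    by (subst emeasure_density) auto
  finally show "emeasure ?Q A = emeasure (density ?P ?g) A" .
qed

text \<open>In the logarithm of the density ratio, the quadratic terms in the residual and in
  \<open>X - \<mu>\<close> both have mean 1/2 and opposite signs, so only the constant survives.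
  \<open>V\<close> has arbitrary type because the formula serves both for \<open>U\<close> alone and
  for the pair \<open>(Y, U)\<close>.\<close>

lemma mutual_information_gaussian_residual:
  fixes X :: "'a \<Rightarrow> real" and V :: "'a \<Rightarrow> 'b" and \<alpha> :: "'b \<Rightarrow> real"
  assumes [measurable]: "X \<in> borel_measurable M" "V \<in> measurable M T" "\<alpha> \<in> borel_measurable T"
    and X: "distr M borel X = gaussian_measure \<mu> \<sigma>" and "\<sigma> \<noteq> 0"
    and W: "distr M borel (\<lambda>x. X x - \<alpha> (V x)) = gaussian_measure 0 s" and "s \<noteq> 0"
    and indep: "distr M (borel \<Otimes>\<^sub>M T) (\<lambda>x. (X x - \<alpha> (V x), V x))
      = distr M borel (\<lambda>x. X x - \<alpha> (V x)) \<Otimes>\<^sub>M distr M T V"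
  shows "mutual_information (exp 1) borel T X V = ln (\<sigma>\<^sup>2 / s\<^sup>2) / 2"
    and "mutual_information_nats M borel T X V = ereal (ln (\<sigma>\<^sup>2 / s\<^sup>2) / 2)"
proof -
  define P where "P = distr M borel X \<Otimes>\<^sub>M distr M T V"
  define Q where "Q = distr M (borel \<Otimes>\<^sub>M T) (\<lambda>x. (X x, V x))"
  define g where "g = (\<lambda>(x, v). normal_density (\<alpha> v) s x / normal_density \<mu> \<sigma> x)"
  have [measurable_cong]: "sets P = sets (borel \<Otimes>\<^sub>M T)"
    unfolding P_def by (intro sets_pair_measure_cong) simp_all
  have g_meas [measurable]: "g \<in> borel_measurable P"
    unfolding g_def by (auto simp: normal_density_def)
  have ln_g: "ln (g (X x, V x)) = ln (\<sigma>\<^sup>2 / s\<^sup>2) / 2 - (X x - \<alpha> (V x))\<^sup>2 / (2 * s\<^sup>2) + (X x - \<mu>)\<^sup>2 / (2 * \<sigma>\<^sup>2)" for x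
    using \<open>\<sigma> \<noteq> 0\<close> \<open>s \<noteq> 0\<close> by (simp add: g_def ln_normal_density_ratio)
  note mW = gaussian_rv_integrable_square[OF _ W] gaussian_rv_expectation_square[OF _ W]
  have int_sq: "integrable M (\<lambda>x. (X x - \<mu>)\<^sup>2)" and E_sq: "expectation (\<lambda>x. (X x - \<mu>)\<^sup>2) = \<sigma>\<^sup>2"
    by (rule gaussian_rv_centered[OF _ X]; simp)+
  have P: "prob_space P"
  proof -
    interpret X: prob_space "distr M borel X" by (rule prob_space_distr) simp
    interpret V: prob_space "distr M T V" by (rule prob_space_distr) simp
    interpret pair_prob_space "distr M borel X" "distr M T V" ..
    show ?thesis unfolding P_def by unfold_locales
  qed
  have pos: "0 < g z" for z
    using \<open>\<sigma> \<noteq> 0\<close> \<open>s \<noteq> 0\<close> by (auto simp: g_def normal_density_pos' split: prod.split)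
  have Q: "Q = density P g"
    using distr_eq_density_if_gaussian_residual[OF assms]
    by (simp add: P_def Q_def g_def case_prod_beta')
  have int: "integrable Q (\<lambda>z. ln (g z))"
    unfolding Q_def using int_sq mW
    by (subst integrable_distr_eq) (auto simp: ln_g g_def[symmetric] intro!: borel_measurable_ln g_meas)
  have "(\<integral>z. ln (g z) \<partial>Q) = expectation (\<lambda>x. ln (g (X x, V x)))"
    unfolding Q_def by (subst integral_distr) auto
  also have "\<dots> = ln (\<sigma>\<^sup>2 / s\<^sup>2) / 2"
    using int_sq E_sq mW \<open>\<sigma> \<noteq> 0\<close> \<open>s \<noteq> 0\<close> by (simp add: ln_g prob_space)
  finally have E: "(\<integral>z. ln (g z) \<partial>Q) = ln (\<sigma>\<^sup>2 / s\<^sup>2) / 2" .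
  note KL = KL_divergence_density[OF P g_meas pos Q int]
  show *: "mutual_information (exp 1) borel T X V = ln (\<sigma>\<^sup>2 / s\<^sup>2) / 2"
    using KL(3) E by (simp add: mutual_information_def P_def Q_def)
  show "mutual_information_nats M borel T X V = ereal (ln (\<sigma>\<^sup>2 / s\<^sup>2) / 2)"
    using KL(1,2) * by (simp add: mutual_information_nats_def P_def Q_def)
qed

text \<open>Gibbs' inequality with a normal trial density of variance \<open>d\<close> around the
  estimate \<open>\<alpha> v\<close>. The term 1/2 is the mean of
  \<open>(X - \<mu>)^2 / (2 * \<sigma>^2)\<close>. Keeping \<open>d\<close> free, rather than
  setting it to the mean square error, avoids a special case for error 0.\<close>

lemma mutual_information_ge_distortion:
  fixes X :: "'a \<Rightarrow> real" and V :: "'a \<Rightarrow> 'b" and \<alpha> :: "'b \<Rightarrow> real"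
  assumes [measurable]: "X \<in> borel_measurable M" "V \<in> measurable M T" "\<alpha> \<in> borel_measurable T"
    and X: "distr M borel X = gaussian_measure \<mu> \<sigma>" and "\<sigma> \<noteq> 0"
    and D: "integrable M (\<lambda>x. (X x - \<alpha> (V x))\<^sup>2)" and "0 < d"
    and I: "mutual_information_nats M borel T X V < \<infinity>"
  shows "ln (\<sigma>\<^sup>2 / d) / 2 + 1 / 2 - expectation (\<lambda>x. (X x - \<alpha> (V x))\<^sup>2) / (2 * d)
    \<le> mutual_information (exp 1) borel T X V"
proof -
  interpret X: prob_space "distr M borel X" by (rule prob_space_distr) simp
  interpret V: prob_space "distr M T V" by (rule prob_space_distr) simp
  interpret XV: pair_prob_space "distr M borel X" "distr M T V" ..
  define P where "P = distr M borel X \<Otimes>\<^sub>M distr M T V"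
  define Q where "Q = distr M (borel \<Otimes>\<^sub>M T) (\<lambda>x. (X x, V x))"
  define s where "s = sqrt d"
  define g where "g = (\<lambda>(x, v). normal_density (\<alpha> v) s x / normal_density \<mu> \<sigma> x)"
  have s: "s \<noteq> 0" "s\<^sup>2 = d"
    using \<open>0 < d\<close> by (simp_all add: s_def)
  have [measurable_cong]: "sets P = sets (borel \<Otimes>\<^sub>M T)"
    unfolding P_def by (intro sets_pair_measure_cong) simp_all
  have g_meas [measurable]: "g \<in> borel_measurable P"
    unfolding g_def by (auto simp: normal_density_def)
  have ln_g: "ln (g (X x, V x)) = ln (\<sigma>\<^sup>2 / d) / 2 - (X x - \<alpha> (V x))\<^sup>2 / (2 * d) + (X x - \<mu>)\<^sup>2 / (2 * \<sigma>\<^sup>2)" for x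
    using \<open>\<sigma> \<noteq> 0\<close> s by (simp add: g_def ln_normal_density_ratio)
  have int_sq: "integrable M (\<lambda>x. (X x - \<mu>)\<^sup>2)" and E_sq: "expectation (\<lambda>x. (X x - \<mu>)\<^sup>2) = \<sigma>\<^sup>2"
    by (rule gaussian_rv_centered[OF _ X]; simp)+
  have pos: "0 < g z" for z
    using \<open>\<sigma> \<noteq> 0\<close> s by (auto simp: g_def normal_density_pos' split: prod.split)
  have Q: "prob_space Q"
    unfolding Q_def by (rule prob_space_distr) simp
  have int: "integrable Q (\<lambda>z. ln (g z))"
    unfolding Q_def using int_sq D
    by (subst integrable_distr_eq) (auto simp: ln_g g_def[symmetric])
  have "(\<integral>\<^sup>+z. g z \<partial>P) = (\<integral>\<^sup>+v. \<integral>\<^sup>+x. g (x, v) \<partial>gaussian_measure \<mu> \<sigma> \<partial>distr M T V)"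
    unfolding P_def X[symmetric] by (subst XV.nn_integral_snd[symmetric]) (auto simp flip: P_def)
  \<comment> \<open>The law of \<open>X\<close> cancels the denominator of \<open>g\<close>, leaving
    the total mass of a normal density for each \<open>v\<close>.\<close>
  also have "\<dots> = (\<integral>\<^sup>+v. \<integral>\<^sup>+x. normal_density (\<alpha> v) s x \<partial>lborel \<partial>distr M T V)"
    using \<open>\<sigma> \<noteq> 0\<close>
    by (intro nn_integral_cong, subst nn_integral_gaussian_measure)
      (auto simp: g_def ennreal_mult''[symmetric] normal_density_pos' less_imp_neq[symmetric])
  also have "\<dots> = 1"
    using V.emeasure_space_1 by (simp add: nn_integral_normal_density s)
  finally have le_1: "(\<integral>\<^sup>+z. g z \<partial>P) \<le> 1"
    by simp
  have ac: "absolutely_continuous P Q" and fin: "integrable Q (entropy_density (exp 1) P Q)"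
    using I by (auto simp: mutual_information_nats_def P_def Q_def Let_def split: if_splits)
  have "ln (\<sigma>\<^sup>2 / d) / 2 + 1 / 2 - expectation (\<lambda>x. (X x - \<alpha> (V x))\<^sup>2) / (2 * d)
      = expectation (\<lambda>x. ln (g (X x, V x)))"
    using int_sq E_sq D \<open>\<sigma> \<noteq> 0\<close> by (simp add: ln_g prob_space)
  also have "\<dots> = (\<integral>z. ln (g z) \<partial>Q)"
    unfolding Q_def by (subst integral_distr) auto
  also have "\<dots> \<le> KL_divergence (exp 1) P Q"
  proof (rule integral_ln_le_KL_divergence[OF _ Q _ ac fin g_meas pos le_1 int])
    show "prob_space P"
      unfolding P_def by (rule XV.prob_space_axioms)
    show "sets Q = sets P"
      unfolding P_def Q_def sets_distr by (intro sets_pair_measure_cong) simp_all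
  qed
  finally show ?thesis
    by (simp add: mutual_information_def P_def Q_def)
qed

end

section \<open>Payoff of an estimator and the Gaussian best response\<close>

lemma ext_expectation_eq_integral:
  assumes "integrable M f"
  shows "ext_expectation M f = ereal (\<integral>x. f x \<partial>M)"
proof -
  have "(\<integral>\<^sup>+x. ennreal (f x) \<partial>M) \<noteq> \<infinity>" "(\<integral>\<^sup>+x. ennreal (- f x) \<partial>M) \<noteq> \<infinity>"
    using assms by (auto simp: real_integrable_def)
  then show ?thesis
    using real_lebesgue_integral_def[OF assms]
    by (cases "\<integral>\<^sup>+x. ennreal (f x) \<partial>M"; cases "\<integral>\<^sup>+x. ennreal (- f x) \<partial>M")
      (simp_all add: ext_expectation_def enn2ereal_ennreal)
qed

text \<open>If the estimator \<open>Z\<close> has infinite mean square error, the positive part of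
  the payoff has infinite mean, while the negative part is dominated by the integrable
  \<open>(Y - X)^2 / \<sigma>^2\<close>. The value is then infinite and the bound is trivial;
  otherwise it is a computation with real integrals.\<close>

lemma ext_expectation_payoff_ge:
  fixes X Y Z :: "'a \<Rightarrow> real"
  assumes [measurable]: "X \<in> borel_measurable M" "Y \<in> borel_measurable M" "Z \<in> borel_measurable M"
    and "\<sigma> \<noteq> 0" and D: "integrable M (\<lambda>x. (Y x - X x)\<^sup>2)"
    and Z: "ennreal v \<le> (\<integral>\<^sup>+x. ennreal ((Z x - X x)\<^sup>2) \<partial>M)"
  shows "ereal ((v - (\<integral>x. (Y x - X x)\<^sup>2 \<partial>M)) / \<sigma>\<^sup>2) \<le> ext_expectation M (\<lambda>x. payoff \<sigma> (X x) (Y x) (Z x))"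
proof (cases "integrable M (\<lambda>x. (Z x - X x)\<^sup>2)")
  case True
  then have "v \<le> (\<integral>x. (Z x - X x)\<^sup>2 \<partial>M)"
    using Z by (subst (asm) nn_integral_eq_integral) (auto simp: ennreal_le_iff)
  moreover have "ext_expectation M (\<lambda>x. payoff \<sigma> (X x) (Y x) (Z x))
      = ereal (((\<integral>x. (Z x - X x)\<^sup>2 \<partial>M) - (\<integral>x. (Y x - X x)\<^sup>2 \<partial>M)) / \<sigma>\<^sup>2)"
    using True D by (subst ext_expectation_eq_integral) (simp_all add: payoff_def)
  ultimately show ?thesis
    by (simp add: divide_right_mono)
next
  case False
  let ?f = "\<lambda>x. payoff \<sigma> (X x) (Y x) (Z x)"
  have [measurable]: "?f \<in> borel_measurable M"
    unfolding payoff_def by simp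
  \<comment> \<open>Solving the payoff for \<open>(Z - X)^2\<close> shows that an integrable payoff
    would force a finite mean square error.\<close>
  have "\<not> integrable M ?f"
  proof
    assume "integrable M ?f"
    then have "integrable M (\<lambda>x. \<sigma>\<^sup>2 * ?f x + (Y x - X x)\<^sup>2)"
      using D by simp
    with False \<open>\<sigma> \<noteq> 0\<close> show False
      by (simp add: payoff_def)
  qed
  moreover have "(\<integral>\<^sup>+x. ennreal (- ?f x) \<partial>M) \<le> (\<integral>\<^sup>+x. ennreal ((Y x - X x)\<^sup>2 / \<sigma>\<^sup>2) \<partial>M)"
    using \<open>\<sigma> \<noteq> 0\<close> by (intro nn_integral_mono ennreal_leI) (simp add: payoff_def field_simps)
  moreover have "(\<integral>\<^sup>+x. ennreal ((Y x - X x)\<^sup>2 / \<sigma>\<^sup>2) \<partial>M) < \<infinity>"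
    using D by (subst nn_integral_eq_integral) auto
  ultimately have "(\<integral>\<^sup>+x. ennreal (?f x) \<partial>M) = \<infinity>" "(\<integral>\<^sup>+x. ennreal (- ?f x) \<partial>M) < \<infinity>"
    by (auto simp: real_integrable_def top_unique less_top[symmetric])
  then show ?thesis
    by (cases "\<integral>\<^sup>+x. ennreal (- ?f x) \<partial>M")
      (simp_all add: ext_expectation_def enn2ereal_ennreal)
qed

lemma distr_gaussian_shift:
  assumes [measurable]: "Z \<in> borel_measurable M" and Z: "distr M borel Z = gaussian_measure m s"
  shows "distr M borel (\<lambda>x. Z x + c) = gaussian_measure (m + c) s"
proof -
  have "distr M borel (\<lambda>x. Z x + c) = distr (distr M borel Z) borel (\<lambda>z. z + c)"
    by (subst distr_distr) (auto simp: comp_def)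
  also have "\<dots> = gaussian_measure (m + c) s"
    unfolding Z gaussian_measure_eq_distr
    by (subst distr_distr) (auto simp: comp_def algebra_simps)
  finally show ?thesis .
qed

context prob_space
begin

text \<open>The error of \<open>z\<close> is \<open>h - w\<close> with \<open>h\<close> the gap
  between \<open>z\<close> and \<open>\<alpha>\<close>, a function of \<open>V\<close>, and
  \<open>w\<close> the independent centered residual. For fixed \<open>h\<close> its mean square is
  \<open>h^2 + s^2\<close>. Nonnegative integrals admit every measurable \<open>z\<close>, whether
  or not its error is square integrable.\<close>

lemma residual_square_le:
  fixes X :: "'a \<Rightarrow> real" and V :: "'a \<Rightarrow> 'b" and \<alpha> z :: "'b \<Rightarrow> real"
  assumes [measurable]: "X \<in> borel_measurable M" "V \<in> measurable M T" "\<alpha> \<in> borel_measurable T"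
      "z \<in> borel_measurable T"
    and W: "distr M borel (\<lambda>x. X x - \<alpha> (V x)) = gaussian_measure 0 s"
    and indep: "distr M (borel \<Otimes>\<^sub>M T) (\<lambda>x. (X x - \<alpha> (V x), V x))
      = distr M borel (\<lambda>x. X x - \<alpha> (V x)) \<Otimes>\<^sub>M distr M T V"
  shows "ennreal (s\<^sup>2) \<le> (\<integral>\<^sup>+x. ennreal ((z (V x) - X x)\<^sup>2) \<partial>M)"
proof -
  interpret T: prob_space "distr M T V"
    by (rule prob_space_distr) simp
  interpret W: prob_space "gaussian_measure 0 s"
    by (rule prob_space_gaussian_measure)
  interpret WT: pair_sigma_finite "gaussian_measure 0 s" "distr M T V" ..
  note moments = gaussian_measure_moments[of 0 s]
  have inner: "ennreal (s\<^sup>2) \<le> (\<integral>\<^sup>+w. ennreal ((h - w)\<^sup>2) \<partial>gaussian_measure 0 s)" for h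
  proof -
    have sq: "(h - w)\<^sup>2 = h\<^sup>2 - 2 * h * w + w\<^sup>2" for w
      by (simp add: power2_eq_square algebra_simps)
    have "integrable (gaussian_measure 0 s) (\<lambda>w. (h - w)\<^sup>2)"
      unfolding sq using moments by simp
    then have "(\<integral>\<^sup>+w. ennreal ((h - w)\<^sup>2) \<partial>gaussian_measure 0 s)
        = ennreal (\<integral>w. (h - w)\<^sup>2 \<partial>gaussian_measure 0 s)"
      by (intro nn_integral_eq_integral) auto
    also have "(\<integral>w. (h - w)\<^sup>2 \<partial>gaussian_measure 0 s) = h\<^sup>2 + s\<^sup>2"
      unfolding sq using moments W.prob_space by simp
    finally show ?thesis
      by (simp add: ennreal_leI)
  qed
  have "ennreal (s\<^sup>2) = (\<integral>\<^sup>+v. ennreal (s\<^sup>2) \<partial>distr M T V)"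
    using T.emeasure_space_1 by simp
  also have "\<dots> \<le> (\<integral>\<^sup>+v. \<integral>\<^sup>+w. ennreal ((z v - \<alpha> v - w)\<^sup>2) \<partial>gaussian_measure 0 s \<partial>distr M T V)"
    by (intro nn_integral_mono inner)
  also have "\<dots> = (\<integral>\<^sup>+q. (\<lambda>(w, v). ennreal ((z v - \<alpha> v - w)\<^sup>2)) q \<partial>(gaussian_measure 0 s \<Otimes>\<^sub>M distr M T V))"
    by (subst WT.nn_integral_snd[symmetric]) auto
  also have "\<dots> = (\<integral>\<^sup>+x. ennreal ((z (V x) - X x)\<^sup>2) \<partial>M)"
    unfolding W[symmetric] indep[symmetric] by (subst nn_integral_distr) auto
  finally show ?thesis .
qed

text \<open>The slope \<open>b\<close> makes the residual uncorrelated with \<open>U\<close> and the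
  intercept \<open>a\<close> centers it. Residual and \<open>U\<close> have Gaussian linear
  combinations, so uncorrelatedness upgrades to independence.\<close>

lemma gaussian_regression:
  fixes X U :: "'a \<Rightarrow> real"
  assumes [measurable]: "X \<in> borel_measurable M" "U \<in> borel_measurable M"
    and gaussian: "\<And>p q. \<exists>m s. distr M borel (\<lambda>x. p * X x + q * U x) = gaussian_measure m s"
  obtains a b s where "distr M borel (\<lambda>x. X x - (a + b * U x)) = gaussian_measure 0 s"
    and "distr M (borel \<Otimes>\<^sub>M borel) (\<lambda>x. (X x - (a + b * U x), U x))
      = distr M borel (\<lambda>x. X x - (a + b * U x)) \<Otimes>\<^sub>M distr M borel U"
proof -
  obtain m s where "distr M borel X = gaussian_measure m s"
    using gaussian[of 1 0] by auto
  then have X: "integrable M X" "integrable M (\<lambda>x. (X x)\<^sup>2)"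
    by (auto intro: gaussian_rv_integrable gaussian_rv_integrable_square)
  obtain m s where "distr M borel U = gaussian_measure m s"
    using gaussian[of 0 1] by auto
  then have U: "integrable M U" "integrable M (\<lambda>x. (U x)\<^sup>2)"
    by (auto intro: gaussian_rv_integrable gaussian_rv_integrable_square)
  have XU: "integrable M (\<lambda>x. X x * U x)"
    using X U by (intro integrable_mult_if_integrable_square) auto
  define cov where "cov = expectation (\<lambda>x. X x * U x) - expectation X * expectation U"
  \<comment> \<open>The usual slope is \<open>cov / variance U\<close>. If the variance is 0, then
    \<open>U\<close> is almost surely constant, the covariance vanishes too, and any slope
    works.\<close>
  have "\<exists>b. cov = b * variance U"
  proof (cases "variance U = 0")
    case True
    have "integrable M (\<lambda>x. (U x - expectation U)\<^sup>2)"
      using U by (simp add: power2_diff)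
    with True have "AE x in M. (U x - expectation U)\<^sup>2 = 0"
      by (subst (asm) integral_nonneg_eq_0_iff_AE) auto
    then have "AE x in M. X x * U x = X x * expectation U"
      by eventually_elim simp
    then have "expectation (\<lambda>x. X x * U x) = expectation (\<lambda>x. X x * expectation U)"
      by (intro integral_cong_AE) auto
    then show ?thesis
      using X True by (simp add: cov_def)
  next
    case False
    then show ?thesis
      by (intro exI[of _ "cov / variance U"]) simp
  qed
  then obtain b where b: "cov = b * variance U" ..
  define a where "a = expectation X - b * expectation U"
  define W where "W x = X x - (a + b * U x)" for x
  have [measurable]: "W \<in> borel_measurable M"
    unfolding W_def[abs_def] by simp
  have EW: "expectation W = 0"
    unfolding W_def[abs_def] using X U by (simp add: a_def prob_space)
  \<comment> \<open>A combination of \<open>W\<close> and \<open>U\<close> is one of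
    \<open>X\<close> and \<open>U\<close> up to a constant shift.\<close>
  have combination: "\<exists>m s. distr M borel (\<lambda>x. p * W x + q * U x) = gaussian_measure m s" for p q
  proof -
    obtain m s where "distr M borel (\<lambda>x. p * X x + (q - p * b) * U x) = gaussian_measure m s"
      using gaussian[of p "q - p * b"] by blast
    from distr_gaussian_shift[OF _ this, of "- p * a"] show ?thesis
      by (auto simp: W_def algebra_simps)
  qed
  have "W x * U x = X x * U x - a * U x - b * (U x)\<^sup>2" for x
    by (simp add: W_def power2_eq_square algebra_simps)
  then have "expectation (\<lambda>x. W x * U x)
      = expectation (\<lambda>x. X x * U x) - a * expectation U - b * expectation (\<lambda>x. (U x)\<^sup>2)"
    using X U XU by simp
  also have "\<dots> = cov - b * variance U"
    using U by (simp add: cov_def a_def variance_eq prob_space power2_eq_square algebra_simps)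
  finally have "expectation (\<lambda>x. W x * U x) = expectation W * expectation U"
    using b EW by simp
  then have "indep_var borel W borel U"
    using combination by (intro indep_var_if_uncorrelated_gaussian) auto
  then have "distr M (borel \<Otimes>\<^sub>M borel) (\<lambda>x. (W x, U x)) = distr M borel W \<Otimes>\<^sub>M distr M borel U"
    by (simp add: indep_var_distribution_eq)
  moreover obtain m s where W: "distr M borel W = gaussian_measure m s"
    using combination[of 1 0] by auto
  moreover have "m = 0"
    using gaussian_rv_expectation[OF _ W] EW by simp
  ultimately show ?thesis
    by (intro that[of a b s]) (simp_all add: W_def[abs_def])
qed

section \<open>Upper bound on the payoff from the rate constraints\<close>

text \<open>Choosing the claimed bound \<open>d\<close> itself as the trial variance cancels the
  logarithm against the rate and leaves \<open>1 / 2 \<le> D / (2 * d)\<close>, where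
  \<open>D\<close> is the mean square error.\<close>

lemma distortion_ge:
  fixes X :: "'a \<Rightarrow> real" and V :: "'a \<Rightarrow> 'b" and \<alpha> :: "'b \<Rightarrow> real"
  assumes "X \<in> borel_measurable M" "V \<in> measurable M T" "\<alpha> \<in> borel_measurable T"
    and "distr M borel X = gaussian_measure \<mu> \<sigma>" and "\<sigma> \<noteq> 0"
    and "integrable M (\<lambda>x. (X x - \<alpha> (V x))\<^sup>2)"
    and "mutual_information_nats M borel T X V < \<infinity>"
    and "0 < d" and I: "mutual_information (exp 1) borel T X V \<le> ln (\<sigma>\<^sup>2 / d) / 2"
  shows "d \<le> expectation (\<lambda>x. (X x - \<alpha> (V x))\<^sup>2)"
proof -
  have "1 / 2 \<le> expectation (\<lambda>x. (X x - \<alpha> (V x))\<^sup>2) / (2 * d)"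
    using mutual_information_ge_distortion[OF assms(1-6) \<open>0 < d\<close> assms(7)] I by simp
  with \<open>0 < d\<close> show ?thesis
    by (simp add: field_simps)
qed

text \<open>The smaller rate decides which lower bound on the distortion is used;
  \<open>s^2 \<le> \<sigma>^2\<close> then removes \<open>s\<close> from the resulting payoff
  bound.\<close>

lemma residual_payoff_le:
  fixes X Y U :: "'a \<Rightarrow> real" and \<alpha> :: "real \<Rightarrow> real"
  assumes [measurable]: "X \<in> borel_measurable M" "Y \<in> borel_measurable M" "U \<in> borel_measurable M"
      "\<alpha> \<in> borel_measurable borel"
    and X: "distr M borel X = gaussian_measure \<mu> \<sigma>" and "\<sigma> \<noteq> 0"
    and D: "integrable M (\<lambda>x. (Y x - X x)\<^sup>2)"
    and W: "distr M borel (\<lambda>x. X x - \<alpha> (U x)) = gaussian_measure 0 s"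
    and indep: "distr M (borel \<Otimes>\<^sub>M borel) (\<lambda>x. (X x - \<alpha> (U x), U x))
      = distr M borel (\<lambda>x. X x - \<alpha> (U x)) \<Otimes>\<^sub>M distr M borel U"
    and "0 \<le> Rs"
    and R: "mutual_information_nats M borel (borel \<Otimes>\<^sub>M borel) X (\<lambda>x. (Y x, U x)) \<le> ereal R"
    and Rs: "conditional_mutual_information (exp 1) borel borel borel X Y U \<le> Rs"
  shows "(s\<^sup>2 - expectation (\<lambda>x. (Y x - X x)\<^sup>2)) / \<sigma>\<^sup>2 \<le> 1 - exp (- 2 * min Rs R)"
proof -
  let ?D = "expectation (\<lambda>x. (Y x - X x)\<^sup>2)"
  let ?I = "mutual_information (exp 1) borel (borel \<Otimes>\<^sub>M borel) X (\<lambda>x. (Y x, U x))"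
  have fin: "mutual_information_nats M borel (borel \<Otimes>\<^sub>M borel) X (\<lambda>x. (Y x, U x)) < \<infinity>"
    using R by (auto simp: order.strict_trans1)
  have I_le: "?I \<le> R"
    using R fin by (auto simp: mutual_information_nats_def Let_def split: if_splits)
  \<comment> \<open>The observation is \<open>(Y, U)\<close> and the estimate of \<open>X\<close>
    from it is \<open>Y\<close>, hence \<open>\<alpha> = fst\<close>.\<close>
  have distortion: "d \<le> ?D" if "0 < d" "?I \<le> ln (\<sigma>\<^sup>2 / d) / 2" for d
    using distortion_ge[OF _ _ _ X \<open>\<sigma> \<noteq> 0\<close> _ fin that, where \<alpha> = fst] D
    by (simp add: power2_commute)
  have s_le: "s\<^sup>2 \<le> \<sigma>\<^sup>2"
  proof -
    have int: "integrable M (\<lambda>x. (\<mu> - X x)\<^sup>2)" and E: "expectation (\<lambda>x. (\<mu> - X x)\<^sup>2) = \<sigma>\<^sup>2"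
      using gaussian_rv_centered[OF _ X] by (simp_all add: power2_commute)
    \<comment> \<open>The constant estimator \<open>\<mu>\<close> ignores \<open>U\<close> and has
      error \<open>\<sigma>^2\<close>, so the best error cannot be larger.\<close>
    have "ennreal (s\<^sup>2) \<le> (\<integral>\<^sup>+x. ennreal ((\<mu> - X x)\<^sup>2) \<partial>M)"
      using residual_square_le[OF _ _ _ _ W indep, of "\<lambda>_. \<mu>"] by simp
    also have "\<dots> = ennreal (\<sigma>\<^sup>2)"
      using int by (subst nn_integral_eq_integral) (simp_all add: E)
    finally show ?thesis
      by simp
  qed
  have "0 < \<sigma>\<^sup>2"
    using \<open>\<sigma> \<noteq> 0\<close> by simp
  show ?thesis
  proof (cases "Rs \<le> R")
    case False
    \<comment> \<open>With this \<open>d\<close> the threshold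
      \<open>ln (\<sigma>^2 / d) / 2\<close> is exactly \<open>R\<close>.\<close>
    have "\<sigma>\<^sup>2 * exp (- 2 * R) \<le> ?D"
      using \<open>\<sigma> \<noteq> 0\<close> I_le by (intro distortion) (simp_all add: exp_minus[symmetric] ln_div ln_mult)
    with s_le False \<open>0 < \<sigma>\<^sup>2\<close> show ?thesis
      by (simp add: field_simps)
  next
    case True
    have "s\<^sup>2 * exp (- 2 * Rs) \<le> ?D"
    proof (cases "s = 0")
      case False
      \<comment> \<open>Chain rule: I(X;Y,U) is I(X;Y|U) plus I(X;U), the latter known from the
        residual. The right side is the threshold for \<open>d = s^2 * exp (-2 * Rs)\<close>. For
        \<open>s = 0\<close> the bound on the distortion is just nonnegativity.\<close>
      have "?I \<le> Rs + ln (\<sigma>\<^sup>2 / s\<^sup>2) / 2"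
        using Rs mutual_information_gaussian_residual(1)[OF _ _ _ X \<open>\<sigma> \<noteq> 0\<close> W False indep]
        by (simp add: conditional_mutual_information_def)
      then show ?thesis
        using \<open>\<sigma> \<noteq> 0\<close> False
        by (intro distortion) (simp_all add: ln_div ln_mult, simp add: field_simps)
    qed (simp add: integral_nonneg_AE)
    moreover have "s\<^sup>2 * (1 - exp (- 2 * Rs)) \<le> \<sigma>\<^sup>2 * (1 - exp (- 2 * Rs))"
      using s_le \<open>0 \<le> Rs\<close> by (intro mult_right_mono) auto
    ultimately show ?thesis
      using True \<open>0 < \<sigma>\<^sup>2\<close> by (simp add: field_simps min_absorb1)
  qed
qed

end

section \<open>The inner minimum over estimators\<close>

text \<open>The estimator \<open>\<alpha>\<close> leaves exactly the residual, of mean square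
  \<open>s^2\<close>, and independence keeps every other estimator at or above this error. The
  distortion of \<open>Y\<close> is an offset common to all estimators.\<close>

lemma is_minimum_expected_payoff:
  assumes J: "prob_space J" and [measurable_cong]: "sets J = sets (borel \<Otimes>\<^sub>M borel \<Otimes>\<^sub>M borel)"
    and [measurable]: "\<alpha> \<in> borel_measurable borel" and "\<sigma> \<noteq> 0"
    and D: "integrable J (\<lambda>\<omega>. (Y_of \<omega> - X_of \<omega>)\<^sup>2)"
    and W: "distr J borel (\<lambda>\<omega>. X_of \<omega> - \<alpha> (U_of \<omega>)) = gaussian_measure 0 s"
    and indep: "distr J (borel \<Otimes>\<^sub>M borel) (\<lambda>\<omega>. (X_of \<omega> - \<alpha> (U_of \<omega>), U_of \<omega>))
      = distr J borel (\<lambda>\<omega>. X_of \<omega> - \<alpha> (U_of \<omega>)) \<Otimes>\<^sub>M distr J borel U_of"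
  shows "is_minimum (expected_payoff \<sigma> J ` borel_measurable borel)
    (ereal ((s\<^sup>2 - (\<integral>\<omega>. (Y_of \<omega> - X_of \<omega>)\<^sup>2 \<partial>J)) / \<sigma>\<^sup>2))"
proof -
  interpret J: prob_space J by fact
  have payoff_eq: "expected_payoff \<sigma> J z
      = ext_expectation J (\<lambda>\<omega>. payoff \<sigma> (X_of \<omega>) (Y_of \<omega>) (z (U_of \<omega>)))" for z
    by (simp add: expected_payoff_def case_prod_beta')
  have int_W: "integrable J (\<lambda>\<omega>. (X_of \<omega> - \<alpha> (U_of \<omega>))\<^sup>2)"
    and E_W: "(\<integral>\<omega>. (X_of \<omega> - \<alpha> (U_of \<omega>))\<^sup>2 \<partial>J) = s\<^sup>2"
    using J.gaussian_rv_integrable_square[OF _ W] J.gaussian_rv_expectation_square[OF _ W] by simp_all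
  have "expected_payoff \<sigma> J \<alpha> = ereal ((s\<^sup>2 - (\<integral>\<omega>. (Y_of \<omega> - X_of \<omega>)\<^sup>2 \<partial>J)) / \<sigma>\<^sup>2)"
    unfolding payoff_eq using int_W E_W D
    by (subst ext_expectation_eq_integral) (simp_all add: payoff_def power2_commute)
  moreover have "ereal ((s\<^sup>2 - (\<integral>\<omega>. (Y_of \<omega> - X_of \<omega>)\<^sup>2 \<partial>J)) / \<sigma>\<^sup>2) \<le> expected_payoff \<sigma> J z"
    if [measurable]: "z \<in> borel_measurable borel" for z
    unfolding payoff_eq
    by (rule ext_expectation_payoff_ge[OF _ _ _ \<open>\<sigma> \<noteq> 0\<close> D J.residual_square_le[OF _ _ _ _ W indep]])
      simp_all
  ultimately show ?thesis
    unfolding is_minimum_def using assms(3) by (auto simp: image_iff dest: sym)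
qed

section \<open>Joint laws generated by kernels\<close>

lemma joint_law_facts:
  assumes K: "K \<in> kernels"
  shows sets_joint_law: "sets (joint_law \<mu> \<sigma> K) = sets (borel \<Otimes>\<^sub>M borel \<Otimes>\<^sub>M borel)"
    and prob_space_joint_law: "prob_space (joint_law \<mu> \<sigma> K)"
    and distr_X_joint_law: "distr (joint_law \<mu> \<sigma> K) borel X_of = gaussian_measure \<mu> \<sigma>"
proof -
  let ?G = "gaussian_measure \<mu> \<sigma>"
  let ?N = "\<lambda>x. distr (K x) (borel \<Otimes>\<^sub>M borel \<Otimes>\<^sub>M borel) (Pair x)"
  have [measurable]: "K \<in> borel \<rightarrow>\<^sub>M prob_algebra (borel \<Otimes>\<^sub>M borel)"
    using K by (simp add: kernels_def)
  have G: "?G \<in> space (prob_algebra borel)"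
    using prob_space_gaussian_measure by (simp add: space_prob_algebra)
  have N: "?N \<in> borel \<rightarrow>\<^sub>M prob_algebra (borel \<Otimes>\<^sub>M borel \<Otimes>\<^sub>M borel)"
    by measurable
  show "sets (joint_law \<mu> \<sigma> K) = sets (borel \<Otimes>\<^sub>M borel \<Otimes>\<^sub>M borel)"
    unfolding joint_law_def by (rule sets_bind'[OF G N])
  show "prob_space (joint_law \<mu> \<sigma> K)"
    unfolding joint_law_def by (rule prob_space_bind'[OF G N])
  have K_prob: "prob_space (K x)" "sets (K x) = sets (borel \<Otimes>\<^sub>M borel)" for x
    using measurable_space[of K borel "prob_algebra (borel \<Otimes>\<^sub>M borel)" x]
    by (auto simp: space_prob_algebra)
  have "distr (joint_law \<mu> \<sigma> K) borel X_of = ?G \<bind> (\<lambda>x. distr (?N x) borel X_of)"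
    unfolding joint_law_def
    by (rule distr_bind[where K = "borel \<Otimes>\<^sub>M borel \<Otimes>\<^sub>M borel"])
      (use N[THEN measurable_prob_algebraD] in \<open>auto cong: measurable_cong_sets\<close>)
  \<comment> \<open>Under the law generated at \<open>x\<close> the first coordinate is constantly
    \<open>x\<close>, so its image is a point mass.\<close>
  also have "(\<lambda>x. distr (?N x) borel X_of) = return borel"
  proof
    fix x
    interpret prob_space "K x" by (rule K_prob)
    have "distr (?N x) borel X_of = distr (K x) borel (\<lambda>_. x)"
      by (subst distr_distr) (auto simp: comp_def measurable_cong_sets[OF K_prob(2)])
    then show "distr (?N x) borel X_of = return borel x" by simp
  qed
  also have "?G \<bind> return borel = ?G"
    by (rule bind_return'') simp
  finally show "distr (joint_law \<mu> \<sigma> K) borel X_of = ?G" .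
qed

text \<open>A kernel that feeds \<open>x\<close> and fresh noise through a function gives a joint
  law that is an image of a product measure, so computations reduce to two independent
  variables.\<close>

lemma joint_law_distr:
  assumes N: "prob_space N" and [measurable_cong]: "sets N = sets borel"
    and [measurable]: "case_prod f \<in> borel \<Otimes>\<^sub>M borel \<rightarrow>\<^sub>M borel \<Otimes>\<^sub>M borel"
  shows "(\<lambda>x. distr N (borel \<Otimes>\<^sub>M borel) (f x)) \<in> kernels"
    and "joint_law \<mu> \<sigma> (\<lambda>x. distr N (borel \<Otimes>\<^sub>M borel) (f x))
      = distr (gaussian_measure \<mu> \<sigma> \<Otimes>\<^sub>M N) (borel \<Otimes>\<^sub>M borel \<Otimes>\<^sub>M borel) (\<lambda>(x, n). (x, f x n))"
proof -
  let ?K = "\<lambda>x. distr N (borel \<Otimes>\<^sub>M borel) (f x)"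
  interpret N: prob_space N by fact
  have [measurable]: "(\<lambda>_. N) \<in> borel \<rightarrow>\<^sub>M prob_algebra borel"
    using N by (intro measurable_const) (auto simp: space_prob_algebra assms)
  have [measurable]: "?K \<in> borel \<rightarrow>\<^sub>M prob_algebra (borel \<Otimes>\<^sub>M borel)"
    by measurable
  then show K: "?K \<in> kernels"
    by (simp add: kernels_def)
  show "joint_law \<mu> \<sigma> ?K
      = distr (gaussian_measure \<mu> \<sigma> \<Otimes>\<^sub>M N) (borel \<Otimes>\<^sub>M borel \<Otimes>\<^sub>M borel) (\<lambda>(x, n). (x, f x n))"
    (is "?J = ?D")
  proof (rule measure_eqI)
    show "sets ?J = sets ?D"
      using sets_joint_law[OF K] by simp
    fix A assume "A \<in> sets ?J"
    then have [measurable]: "A \<in> sets (borel \<Otimes>\<^sub>M borel \<Otimes>\<^sub>M borel)"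
      using sets_joint_law[OF K] by simp
    have "emeasure ?J A = (\<integral>\<^sup>+x. emeasure (distr (?K x) (borel \<Otimes>\<^sub>M borel \<Otimes>\<^sub>M borel) (Pair x)) A
        \<partial>gaussian_measure \<mu> \<sigma>)"
      unfolding joint_law_def
      by (rule emeasure_bind_prob_algebra[where N = borel and L = "borel \<Otimes>\<^sub>M borel \<Otimes>\<^sub>M borel"])
        (use prob_space_gaussian_measure in \<open>auto simp: space_prob_algebra\<close>)
    also have "\<dots> = (\<integral>\<^sup>+x. \<integral>\<^sup>+n. indicator A (x, f x n) \<partial>N \<partial>gaussian_measure \<mu> \<sigma>)"
    proof (rule nn_integral_cong)
      fix x
      have "emeasure (distr (?K x) (borel \<Otimes>\<^sub>M borel \<Otimes>\<^sub>M borel) (Pair x)) A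
          = (\<integral>\<^sup>+q. indicator A q \<partial>distr (?K x) (borel \<Otimes>\<^sub>M borel \<Otimes>\<^sub>M borel) (Pair x))"
        by simp
      also have "\<dots> = (\<integral>\<^sup>+q. indicator A (x, q) \<partial>?K x)"
        by (subst nn_integral_distr) auto
      also have "\<dots> = (\<integral>\<^sup>+n. indicator A (x, f x n) \<partial>N)"
        by (subst nn_integral_distr) auto
      finally show "emeasure (distr (?K x) (borel \<Otimes>\<^sub>M borel \<Otimes>\<^sub>M borel) (Pair x)) A
          = (\<integral>\<^sup>+n. indicator A (x, f x n) \<partial>N)" .
    qed
    also have "\<dots> = (\<integral>\<^sup>+q. (\<lambda>(x, n). indicator A (x, f x n)) q \<partial>(gaussian_measure \<mu> \<sigma> \<Otimes>\<^sub>M N))"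
      by (subst N.nn_integral_fst[symmetric]) auto
    also have "\<dots> = (\<integral>\<^sup>+q. indicator A q \<partial>?D)"
      by (subst nn_integral_distr) (auto simp: case_prod_beta')
    finally show "emeasure ?J A = emeasure ?D A"
      by simp
  qed
qed

text \<open>Characteristic functions multiply under independence and the squared scales add. Working
  with them instead of convolving densities also covers zero coefficients and point masses.\<close>

lemma distr_gaussian_product:
  "distr (gaussian_measure m\<^sub>1 s\<^sub>1 \<Otimes>\<^sub>M gaussian_measure m\<^sub>2 s\<^sub>2) borel (\<lambda>(x, n). c + k * x + l * n)
    = gaussian_measure (c + k * m\<^sub>1 + l * m\<^sub>2) (sqrt ((k * s\<^sub>1)\<^sup>2 + (l * s\<^sub>2)\<^sup>2))"
    (is "distr (?G \<Otimes>\<^sub>M ?N) borel ?f = _")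
proof (rule Levy_uniqueness)
  interpret G: prob_space ?G by (rule prob_space_gaussian_measure)
  interpret N: prob_space ?N by (rule prob_space_gaussian_measure)
  interpret GN: pair_prob_space ?G ?N ..
  show "real_distribution (distr (?G \<Otimes>\<^sub>M ?N) borel ?f)"
    by (rule GN.real_distribution_distr) simp
  show "char (distr (?G \<Otimes>\<^sub>M ?N) borel ?f)
      = char (gaussian_measure (c + k * m\<^sub>1 + l * m\<^sub>2) (sqrt ((k * s\<^sub>1)\<^sup>2 + (l * s\<^sub>2)\<^sup>2)))"
  proof
    fix t
    have "char (distr (?G \<Otimes>\<^sub>M ?N) borel ?f) t = (CLINT q|?G \<Otimes>\<^sub>M ?N. iexp (t * ?f q))"
      unfolding char_def by (subst integral_distr) auto
    also have "\<dots> = (CLINT x|?G. CLINT n|?N. iexp (t * ?f (x, n)))"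
      by (subst GN.integral_fst'[symmetric]) (auto intro!: GN.P.integrable_const_bound[of _ 1] simp: case_prod_beta')
    also have "\<dots> = (CLINT x|?G. CLINT n|?N. iexp (t * c) * iexp ((t * k) * x) * iexp ((t * l) * n))"
      by (simp add: distrib_left exp_add mult.assoc)
    also have "\<dots> = iexp (t * c) * char ?G (t * k) * char ?N (t * l)"
      by (simp add: char_def)
    also have "\<dots> = char (gaussian_measure (c + k * m\<^sub>1 + l * m\<^sub>2) (sqrt ((k * s\<^sub>1)\<^sup>2 + (l * s\<^sub>2)\<^sup>2))) t"
    proof -
      have "iexp (t * c) * iexp (t * k * m\<^sub>1) * iexp (t * l * m\<^sub>2) = iexp (t * (c + k * m\<^sub>1 + l * m\<^sub>2))"
        by (simp add: distrib_left exp_add mult.assoc)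
      moreover have "exp (- (s\<^sub>1 * (t * k))\<^sup>2 / 2) * exp (- (s\<^sub>2 * (t * l))\<^sup>2 / 2)
          = exp (- (sqrt ((k * s\<^sub>1)\<^sup>2 + (l * s\<^sub>2)\<^sup>2) * t)\<^sup>2 / 2)"
        by (simp add: exp_add[symmetric] power_mult_distrib algebra_simps add_divide_distrib)
      moreover have "a * (b * of_real d) * (e * of_real f) = (a * b * e) * of_real (d * f)"
        for a b e :: complex and d f
        by simp
      ultimately show ?thesis
        unfolding char_gaussian_measure by (simp only:)
    qed
    finally show "char (distr (?G \<Otimes>\<^sub>M ?N) borel ?f) t
      = char (gaussian_measure (c + k * m\<^sub>1 + l * m\<^sub>2) (sqrt ((k * s\<^sub>1)\<^sup>2 + (l * s\<^sub>2)\<^sup>2))) t" .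
  qed
qed (rule real_distribution_gaussian_measure)

section \<open>Value of an arbitrary Gaussian policy\<close>

lemma jointly_gaussian_combination:
  assumes "jointly_gaussian J"
  shows "\<exists>m s. distr J borel (\<lambda>\<omega>. a * X_of \<omega> + b * Y_of \<omega> + c * U_of \<omega>) = gaussian_measure m s"
  using assms unfolding jointly_gaussian_def case_prod_beta' by blast

lemma gaussian_policy_minimum:
  assumes K: "K \<in> gaussian_policies \<mu> \<sigma> R Rs" and "\<sigma> \<noteq> 0" and "0 \<le> Rs"
  obtains v where "is_minimum (expected_payoff \<sigma> (joint_law \<mu> \<sigma> K) ` borel_measurable borel) (ereal v)"
    and "v \<le> 1 - exp (- 2 * min Rs R)"
proof -
  define J where "J = joint_law \<mu> \<sigma> K"
  have kernel: "K \<in> kernels"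
    and rate: "rate_constraints R Rs J" and gaussian: "jointly_gaussian J"
    using K by (simp_all add: gaussian_policies_def policies_def J_def)
  have sets_J [measurable_cong]: "sets J = sets (borel \<Otimes>\<^sub>M borel \<Otimes>\<^sub>M borel)"
    and X: "distr J borel X_of = gaussian_measure \<mu> \<sigma>"
    unfolding J_def using kernel by (rule sets_joint_law distr_X_joint_law)+
  interpret J: prob_space J
    unfolding J_def using kernel by (rule prob_space_joint_law)
  \<comment> \<open>Joint Gaussianity makes the distortion finite, so the value of the policy is a
    real number.\<close>
  obtain m s where "distr J borel (\<lambda>\<omega>. Y_of \<omega> - X_of \<omega>) = gaussian_measure m s"
    using jointly_gaussian_combination[OF gaussian, of "-1" 1 0] by auto
  then have D: "integrable J (\<lambda>\<omega>. (Y_of \<omega> - X_of \<omega>)\<^sup>2)"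
    by (rule J.gaussian_rv_integrable_square[rotated]) measurable
  have "\<exists>m s. distr J borel (\<lambda>\<omega>. p * X_of \<omega> + q * U_of \<omega>) = gaussian_measure m s" for p q
    using jointly_gaussian_combination[OF gaussian, of p 0 q] by auto
  then obtain a b s where
    W: "distr J borel (\<lambda>\<omega>. X_of \<omega> - (a + b * U_of \<omega>)) = gaussian_measure 0 s"
    and indep: "distr J (borel \<Otimes>\<^sub>M borel) (\<lambda>\<omega>. (X_of \<omega> - (a + b * U_of \<omega>), U_of \<omega>))
      = distr J borel (\<lambda>\<omega>. X_of \<omega> - (a + b * U_of \<omega>)) \<Otimes>\<^sub>M distr J borel U_of"
    by (rule J.gaussian_regression[rotated 2]) measurable
  show ?thesis
  proof (rule that)
    show "is_minimum (expected_payoff \<sigma> (joint_law \<mu> \<sigma> K) ` borel_measurable borel)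
        (ereal ((s\<^sup>2 - (\<integral>\<omega>. (Y_of \<omega> - X_of \<omega>)\<^sup>2 \<partial>J)) / \<sigma>\<^sup>2))"
      unfolding J_def[symmetric]
      by (rule is_minimum_expected_payoff[where \<alpha> = "\<lambda>u. a + b * u"])
        (use J.prob_space_axioms sets_J \<open>\<sigma> \<noteq> 0\<close> D W indep in auto)
    show "(s\<^sup>2 - (\<integral>\<omega>. (Y_of \<omega> - X_of \<omega>)\<^sup>2 \<partial>J)) / \<sigma>\<^sup>2 \<le> 1 - exp (- 2 * min Rs R)"
      by (rule J.residual_payoff_le[OF _ _ _ _ X \<open>\<sigma> \<noteq> 0\<close> D W indep \<open>0 \<le> Rs\<close>])
        (use rate in \<open>auto simp: rate_constraints_def\<close>)
  qed
qed

section \<open>Attainment by the backward test channel\<close>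

text \<open>The maximizer is the backward test channel: \<open>U\<close> is constant, and \<open>X = Y + W\<close> with \<open>W\<close>
  independent of \<open>Y\<close> and of variance \<open>(1 - \<theta>) \<sigma>\<^sup>2\<close>.\<close>

definition test_channel :: "real \<Rightarrow> real \<Rightarrow> real \<Rightarrow> real \<Rightarrow> (real \<times> real) measure" where
  "test_channel \<mu> \<sigma> \<theta> x = distr (gaussian_measure 0 1) (borel \<Otimes>\<^sub>M borel)
     (\<lambda>n. (\<mu> + \<theta> * (x - \<mu>) + \<sigma> * sqrt (\<theta> * (1 - \<theta>)) * n, 0))"

text \<open>Since \<open>U\<close> is almost surely constant, the best response is
  \<open>\<mu>\<close> with error \<open>\<sigma>^2\<close>, whereas \<open>Y\<close> has distortion
  \<open>(1 - \<theta>) * \<sigma>^2\<close>; the normalized difference is \<open>\<theta>\<close>.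
  The condition \<open>\<theta> < 1\<close> keeps the residual nondegenerate, hence the rate
  finite.\<close>

lemma test_channel_optimal:
  assumes "\<sigma> \<noteq> 0" and \<theta>: "0 \<le> \<theta>" "\<theta> < 1"
    and R: "- ln (1 - \<theta>) / 2 \<le> R" and Rs: "- ln (1 - \<theta>) / 2 \<le> Rs"
  shows "test_channel \<mu> \<sigma> \<theta> \<in> gaussian_policies \<mu> \<sigma> R Rs"
    and "is_minimum (expected_payoff \<sigma> (joint_law \<mu> \<sigma> (test_channel \<mu> \<sigma> \<theta>)) ` borel_measurable borel)
      (ereal \<theta>)"
proof -
  \<comment> \<open>This noise level gives \<open>Y\<close> the variance
    \<open>\<theta>^2 * \<sigma>^2 + \<tau>^2 = \<theta> * \<sigma>^2\<close>, equal to its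
    covariance with \<open>X\<close>, so that \<open>X - Y\<close> is uncorrelated with
    \<open>Y\<close>.\<close>
  define \<tau> where "\<tau> = \<sigma> * sqrt (\<theta> * (1 - \<theta>))"
  define s where "s = \<sigma> * sqrt (1 - \<theta>)"
  define J where "J = joint_law \<mu> \<sigma> (test_channel \<mu> \<sigma> \<theta>)"
  define f where "f x n = (\<mu> + \<theta> * (x - \<mu>) + \<tau> * n, 0 :: real)" for x n :: real
  let ?GN = "gaussian_measure \<mu> \<sigma> \<Otimes>\<^sub>M gaussian_measure 0 1"
  have \<tau>: "\<tau>\<^sup>2 = \<sigma>\<^sup>2 * (\<theta> * (1 - \<theta>))" and s: "s\<^sup>2 = \<sigma>\<^sup>2 * (1 - \<theta>)" "s \<noteq> 0"
    using \<theta> \<open>\<sigma> \<noteq> 0\<close> by (simp_all add: \<tau>_def s_def power_mult_distrib)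
  have channel: "test_channel \<mu> \<sigma> \<theta> = (\<lambda>x. distr (gaussian_measure 0 1) (borel \<Otimes>\<^sub>M borel) (f x))"
    by (simp add: fun_eq_iff test_channel_def f_def[abs_def] \<tau>_def)
  have [measurable]: "case_prod f \<in> borel \<Otimes>\<^sub>M borel \<rightarrow>\<^sub>M borel \<Otimes>\<^sub>M borel"
    unfolding f_def by simp
  have kernel: "test_channel \<mu> \<sigma> \<theta> \<in> kernels"
    unfolding channel by (rule joint_law_distr) (simp_all add: prob_space_gaussian_measure)
  have J: "J = distr ?GN (borel \<Otimes>\<^sub>M borel \<Otimes>\<^sub>M borel) (\<lambda>(x, n). (x, f x n))"
    unfolding J_def channel by (rule joint_law_distr) (simp_all add: prob_space_gaussian_measure)
  have sets_J [measurable_cong]: "sets J = sets (borel \<Otimes>\<^sub>M borel \<Otimes>\<^sub>M borel)"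
    and X: "distr J borel X_of = gaussian_measure \<mu> \<sigma>"
    unfolding J_def using kernel by (rule sets_joint_law distr_X_joint_law)+
  interpret J: prob_space J
    unfolding J_def using kernel by (rule prob_space_joint_law)
  have combination: "distr J borel (\<lambda>\<omega>. a * X_of \<omega> + b * Y_of \<omega> + c * U_of \<omega>)
      = gaussian_measure ((a + b) * \<mu>) (sqrt (((a + b * \<theta>) * \<sigma>)\<^sup>2 + (b * \<tau>)\<^sup>2))" for a b c
  proof -
    have "distr J borel (\<lambda>\<omega>. a * X_of \<omega> + b * Y_of \<omega> + c * U_of \<omega>)
        = distr ?GN borel (\<lambda>(x, n). b * \<mu> * (1 - \<theta>) + (a + b * \<theta>) * x + (b * \<tau>) * n)"
      unfolding J by (subst distr_distr) (auto simp: comp_def f_def case_prod_beta' algebra_simps)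
    also have "\<dots> = gaussian_measure ((a + b) * \<mu>) (sqrt (((a + b * \<theta>) * \<sigma>)\<^sup>2 + (b * \<tau>)\<^sup>2))"
      unfolding distr_gaussian_product by (simp add: algebra_simps)
    finally show ?thesis .
  qed
  have gaussian: "jointly_gaussian J"
    unfolding jointly_gaussian_def
    using combination by (auto simp: case_prod_beta')
  have U: "AE \<omega> in J. U_of \<omega> = 0"
    unfolding J by (subst AE_distr_iff) (auto simp: f_def case_prod_beta')
  have "((1 - \<theta>) * \<sigma>)\<^sup>2 + \<tau>\<^sup>2 = s\<^sup>2"
    unfolding \<tau> s by (simp add: power2_eq_square algebra_simps)
  \<comment> \<open>A negative \<open>\<sigma>\<close> makes \<open>s\<close> negative, hence the
    absolute value in the scale of the residual.\<close>
  then have "sqrt (((1 - \<theta>) * \<sigma>)\<^sup>2 + \<tau>\<^sup>2) = \<bar>s\<bar>"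
    by simp
  then have W: "distr J borel (\<lambda>\<omega>. X_of \<omega> - Y_of \<omega>) = gaussian_measure 0 \<bar>s\<bar>"
    using combination[of 1 "-1" 0] by simp
  have Y: "distr J borel Y_of = gaussian_measure \<mu> (sqrt ((\<theta> * \<sigma>)\<^sup>2 + \<tau>\<^sup>2))"
    using combination[of 0 1 0] by simp
  have WY: "distr J (borel \<Otimes>\<^sub>M borel) (\<lambda>\<omega>. (X_of \<omega> - Y_of \<omega>, Y_of \<omega>))
      = distr J borel (\<lambda>\<omega>. X_of \<omega> - Y_of \<omega>) \<Otimes>\<^sub>M distr J borel Y_of"
  proof -
    note mX = J.gaussian_rv_integrable_square[OF _ X] J.gaussian_rv_expectation_square[OF _ X]
    note mW = J.gaussian_rv_integrable_square[OF _ W] J.gaussian_rv_expectation_square[OF _ W]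
      J.gaussian_rv_expectation[OF _ W]
    note mY = J.gaussian_rv_integrable_square[OF _ Y] J.gaussian_rv_expectation_square[OF _ Y]
    \<comment> \<open>Polarization reduces the cross moment to second moments of \<open>X\<close>,
      \<open>X - Y\<close> and \<open>Y\<close>, all Gaussian with known scales.\<close>
    have polar: "(X_of \<omega> - Y_of \<omega>) * Y_of \<omega>
        = ((X_of \<omega>)\<^sup>2 - (X_of \<omega> - Y_of \<omega>)\<^sup>2 - (Y_of \<omega>)\<^sup>2) / 2" for \<omega>
      by (cases \<omega>) (simp add: power2_eq_square field_simps)
    have "J.expectation (\<lambda>\<omega>. (X_of \<omega> - Y_of \<omega>) * Y_of \<omega>)
        = ((\<mu>\<^sup>2 + \<sigma>\<^sup>2) - s\<^sup>2 - (\<mu>\<^sup>2 + ((\<theta> * \<sigma>)\<^sup>2 + \<tau>\<^sup>2))) / 2"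
      unfolding polar using mX mW mY by simp
    also have "\<dots> = 0"
      unfolding s(1) \<tau> by (simp add: power2_eq_square algebra_simps)
    finally have uncorrelated: "J.expectation (\<lambda>\<omega>. (X_of \<omega> - Y_of \<omega>) * Y_of \<omega>)
        = J.expectation (\<lambda>\<omega>. X_of \<omega> - Y_of \<omega>) * J.expectation Y_of"
      using mW by simp
    have "J.indep_var borel (\<lambda>\<omega>. X_of \<omega> - Y_of \<omega>) borel Y_of"
    proof (rule J.indep_var_if_uncorrelated_gaussian[OF _ _ _ uncorrelated])
      show "\<exists>m s. distr J borel (\<lambda>\<omega>. p * (X_of \<omega> - Y_of \<omega>) + q * Y_of \<omega>) = gaussian_measure m s" for p q
      proof -
        have "(\<lambda>\<omega>. p * (X_of \<omega> - Y_of \<omega>) + q * Y_of \<omega>)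
            = (\<lambda>\<omega>. p * X_of \<omega> + (q - p) * Y_of \<omega> + 0 * U_of \<omega>)"
          by (auto simp: fun_eq_iff algebra_simps)
        then show ?thesis
          using combination[of p "q - p" 0] by (simp only:) blast
      qed
    qed measurable
    then show ?thesis
      by (simp add: J.indep_var_distribution_eq)
  qed
  \<comment> \<open>Replacing \<open>U\<close> by its almost sure value 0 makes
    \<open>(Y, U)\<close> an image of \<open>Y\<close> alone, and the product form of the law of
    \<open>(X - Y, Y)\<close> carries over to images.\<close>
  have indep: "distr J (borel \<Otimes>\<^sub>M (borel \<Otimes>\<^sub>M borel)) (\<lambda>\<omega>. (X_of \<omega> - Y_of \<omega>, (Y_of \<omega>, U_of \<omega>)))
      = distr J borel (\<lambda>\<omega>. X_of \<omega> - Y_of \<omega>) \<Otimes>\<^sub>M distr J (borel \<Otimes>\<^sub>M borel) (\<lambda>\<omega>. (Y_of \<omega>, U_of \<omega>))"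
  proof -
    let ?W = "distr J borel (\<lambda>\<omega>. X_of \<omega> - Y_of \<omega>)" and ?Y = "distr J borel Y_of"
    have YU: "distr J (borel \<Otimes>\<^sub>M borel) (\<lambda>\<omega>. (Y_of \<omega>, U_of \<omega>))
        = distr ?Y (borel \<Otimes>\<^sub>M borel) (\<lambda>y. (y, 0))"
    proof -
      have "distr J (borel \<Otimes>\<^sub>M borel) (\<lambda>\<omega>. (Y_of \<omega>, U_of \<omega>)) = distr J (borel \<Otimes>\<^sub>M borel) (\<lambda>\<omega>. (Y_of \<omega>, 0))"
        using U by (intro distr_cong_AE) auto
      then show ?thesis
        by (subst distr_distr) (auto simp: comp_def)
    qed
    have "distr J (borel \<Otimes>\<^sub>M (borel \<Otimes>\<^sub>M borel)) (\<lambda>\<omega>. (X_of \<omega> - Y_of \<omega>, (Y_of \<omega>, U_of \<omega>)))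
        = distr J (borel \<Otimes>\<^sub>M (borel \<Otimes>\<^sub>M borel)) (\<lambda>\<omega>. (X_of \<omega> - Y_of \<omega>, (Y_of \<omega>, 0)))"
      using U by (intro distr_cong_AE) auto
    also have "\<dots> = distr (distr J (borel \<Otimes>\<^sub>M borel) (\<lambda>\<omega>. (X_of \<omega> - Y_of \<omega>, Y_of \<omega>)))
        (borel \<Otimes>\<^sub>M (borel \<Otimes>\<^sub>M borel)) (\<lambda>(w, y). (w, (y, 0)))"
      by (subst distr_distr) (auto simp: comp_def)
    also have "\<dots> = distr ?W borel (\<lambda>w. w) \<Otimes>\<^sub>M distr ?Y (borel \<Otimes>\<^sub>M borel) (\<lambda>y. (y, 0))"
      unfolding WY
      by (rule pair_measure_distr[symmetric])
        (auto intro!: prob_space_imp_sigma_finite prob_space.prob_space_distr J.prob_space_distr)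
    also have "distr ?W borel (\<lambda>w. w) = ?W"
      by (rule distr_id2) simp
    finally show ?thesis
      unfolding YU .
  qed
  have W0: "distr J borel (\<lambda>\<omega>. X_of \<omega> - \<mu>) = gaussian_measure 0 \<sigma>"
    using distr_gaussian_shift[OF _ X, of "- \<mu>"] by simp
  have indep0: "distr J (borel \<Otimes>\<^sub>M borel) (\<lambda>\<omega>. (X_of \<omega> - \<mu>, U_of \<omega>))
      = distr J borel (\<lambda>\<omega>. X_of \<omega> - \<mu>) \<Otimes>\<^sub>M distr J borel U_of"
  proof -
    have zero: "J.expectation (\<lambda>\<omega>. (X_of \<omega> - \<mu>) * U_of \<omega>) = 0" "J.expectation U_of = 0"
      using U by (auto intro!: integral_eq_zero_AE)
    have "J.indep_var borel (\<lambda>\<omega>. X_of \<omega> - \<mu>) borel U_of"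
    proof (rule J.indep_var_if_uncorrelated_gaussian)
      show "\<exists>m s. distr J borel (\<lambda>\<omega>. p * (X_of \<omega> - \<mu>) + q * U_of \<omega>) = gaussian_measure m s" for p q
        using distr_gaussian_shift[OF _ combination[of p 0 q], of "- p * \<mu>"]
        by (auto simp: algebra_simps)
    qed (simp_all add: zero)
    then show ?thesis
      by (simp add: J.indep_var_distribution_eq)
  qed
  have ln_ratio: "ln (\<sigma>\<^sup>2 / s\<^sup>2) / 2 = - ln (1 - \<theta>) / 2"
    using \<open>\<sigma> \<noteq> 0\<close> \<theta> by (simp add: s ln_div)
  have "\<bar>s\<bar> \<noteq> 0"
    using s by simp
  \<comment> \<open>Estimating \<open>X\<close> by \<open>Y\<close> from \<open>(Y, U)\<close> gives
    I(X;Y,U); below, the constant estimate \<open>\<mu>\<close> from \<open>U\<close> gives I(X;U) =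
    0. Both constraints therefore compare the same number \<open>- ln (1 - \<theta>) / 2\<close>
    with \<open>R\<close> and \<open>Rs\<close>.\<close>
  note residual = J.mutual_information_gaussian_residual[where \<alpha> = fst and s = "\<bar>s\<bar>"
      and V = "\<lambda>\<omega>. (Y_of \<omega>, U_of \<omega>)", unfolded fst_conv power2_abs,
      OF _ _ _ X \<open>\<sigma> \<noteq> 0\<close> W \<open>\<bar>s\<bar> \<noteq> 0\<close> indep, unfolded ln_ratio]
  have I: "J.mutual_information (exp 1) borel (borel \<Otimes>\<^sub>M borel) X_of (\<lambda>\<omega>. (Y_of \<omega>, U_of \<omega>))
      = - ln (1 - \<theta>) / 2"
    by (rule residual(1)) measurable
  have I_nats: "mutual_information_nats J borel (borel \<Otimes>\<^sub>M borel) X_of (\<lambda>\<omega>. (Y_of \<omega>, U_of \<omega>))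
      = ereal (- ln (1 - \<theta>) / 2)"
    by (rule residual(2)) measurable
  have "J.mutual_information (exp 1) borel borel X_of U_of = ln (\<sigma>\<^sup>2 / \<sigma>\<^sup>2) / 2"
    by (rule J.mutual_information_gaussian_residual(1)[where \<alpha> = "\<lambda>_. \<mu>",
          OF _ _ _ X \<open>\<sigma> \<noteq> 0\<close> W0 \<open>\<sigma> \<noteq> 0\<close> indep0]) measurable
  then have I0: "J.mutual_information (exp 1) borel borel X_of U_of = 0"
    using \<open>\<sigma> \<noteq> 0\<close> by simp
  have "rate_constraints R Rs J"
    unfolding rate_constraints_def J.conditional_mutual_information_def I I_nats I0
    using R Rs by simp
  then show "test_channel \<mu> \<sigma> \<theta> \<in> gaussian_policies \<mu> \<sigma> R Rs"
    using kernel gaussian by (simp add: gaussian_policies_def policies_def J_def)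
  have swap: "(Y_of \<omega> - X_of \<omega>)\<^sup>2 = (X_of \<omega> - Y_of \<omega>)\<^sup>2" for \<omega>
    by (rule power2_commute)
  have D: "integrable J (\<lambda>\<omega>. (Y_of \<omega> - X_of \<omega>)\<^sup>2)"
    unfolding swap by (rule J.gaussian_rv_integrable_square[OF _ W]) measurable
  have E_D: "(\<integral>\<omega>. (Y_of \<omega> - X_of \<omega>)\<^sup>2 \<partial>J) = s\<^sup>2"
    unfolding swap by (subst J.gaussian_rv_expectation_square[OF _ W]) simp_all
  have "(\<sigma>\<^sup>2 - s\<^sup>2) / \<sigma>\<^sup>2 = \<theta>"
    using \<open>\<sigma> \<noteq> 0\<close> by (simp add: s field_simps)
  then show "is_minimum (expected_payoff \<sigma> (joint_law \<mu> \<sigma> (test_channel \<mu> \<sigma> \<theta>)) ` borel_measurable borel)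
      (ereal \<theta>)"
    using is_minimum_expected_payoff[OF J.prob_space_axioms sets_J _ \<open>\<sigma> \<noteq> 0\<close> D W0 indep0]
    unfolding E_D by (simp add: J_def)
qed

section \<open>The maximum over Gaussian policies\<close>

theorem theorem2:
  fixes \<mu>\<^sub>0 \<sigma>\<^sub>0 R Rs :: real
  assumes "\<sigma>\<^sub>0\<^sup>2 > 0" and "R \<ge> 0" and "Rs \<ge> 0"
  shows "(\<forall>K \<in> gaussian_policies \<mu>\<^sub>0 \<sigma>\<^sub>0 R Rs.
            \<exists>m. is_minimum (expected_payoff \<sigma>\<^sub>0 (joint_law \<mu>\<^sub>0 \<sigma>\<^sub>0 K) ` borel_measurable borel) m) \<and>
         is_maximum
           {m. \<exists>K \<in> gaussian_policies \<mu>\<^sub>0 \<sigma>\<^sub>0 R Rs.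
                 is_minimum (expected_payoff \<sigma>\<^sub>0 (joint_law \<mu>\<^sub>0 \<sigma>\<^sub>0 K) ` borel_measurable borel) m}
           (ereal (1 - exp (- 2 * min Rs R)))"
proof
  have \<sigma>: "\<sigma>\<^sub>0 \<noteq> 0"
    using assms(1) by auto
  show "\<forall>K \<in> gaussian_policies \<mu>\<^sub>0 \<sigma>\<^sub>0 R Rs.
      \<exists>m. is_minimum (expected_payoff \<sigma>\<^sub>0 (joint_law \<mu>\<^sub>0 \<sigma>\<^sub>0 K) ` borel_measurable borel) m"
    using gaussian_policy_minimum[OF _ \<sigma> assms(3)] by metis
  \<comment> \<open>The test channel then spends exactly the smaller rate, so it meets both
    constraints; nonnegative rates make \<open>\<theta>\<close> nonnegative.\<close>
  define \<theta> where "\<theta> = 1 - exp (- 2 * min Rs R)"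
  have \<theta>: "0 \<le> \<theta>" "\<theta> < 1" and ln_\<theta>: "- ln (1 - \<theta>) / 2 = min Rs R"
    using assms(2,3) by (simp_all add: \<theta>_def)
  note optimal = test_channel_optimal[OF \<sigma> \<theta>, unfolded ln_\<theta>, OF min.cobounded2 min.cobounded1]
  have upper: "m \<le> ereal \<theta>"
    if K: "K \<in> gaussian_policies \<mu>\<^sub>0 \<sigma>\<^sub>0 R Rs"
      and m: "is_minimum (expected_payoff \<sigma>\<^sub>0 (joint_law \<mu>\<^sub>0 \<sigma>\<^sub>0 K) ` borel_measurable borel) m" for K m
  proof -
    obtain v where v: "is_minimum (expected_payoff \<sigma>\<^sub>0 (joint_law \<mu>\<^sub>0 \<sigma>\<^sub>0 K) ` borel_measurable borel) (ereal v)"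
      and "v \<le> \<theta>"
      using gaussian_policy_minimum[OF K \<sigma> assms(3)] unfolding \<theta>_def by metis
    \<comment> \<open>Both are minima of the same set, so \<open>m\<close> is below the attained
      value \<open>v\<close>.\<close>
    have "m \<le> ereal v"
      using m v unfolding is_minimum_def by blast
    with \<open>v \<le> \<theta>\<close> show ?thesis
      using ereal_less_eq(3) order_trans by blast
  qed
  show "is_maximum
      {m. \<exists>K \<in> gaussian_policies \<mu>\<^sub>0 \<sigma>\<^sub>0 R Rs.
            is_minimum (expected_payoff \<sigma>\<^sub>0 (joint_law \<mu>\<^sub>0 \<sigma>\<^sub>0 K) ` borel_measurable borel) m}
      (ereal (1 - exp (- 2 * min Rs R)))"
    unfolding is_maximum_def \<theta>_def[symmetric] using optimal upper by blast
qed

end
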